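(* Let $g\in\vec{F}$ be an element of the oriented Thompson group with leaf number $n$, let $L_g$ be its oriented Thompson link, and let $|L_g|$ be the number of components of $L_g$. Then $|L_g|\equiv n \pmod 2$.
   Context: A standard dyadic (s.d.) interval is an interval $[\frac{k}{2^m},\frac{k+1}{2^m}]$ with integers $m\ge 0$, $0\le k\le 2^m-1$. An s.d. $n$-partition $\mathcal{I}$ is a partition $0=a_0<a_1<\dots<a_n=1$ (the $a_i$ are its breakpoints) all of whose subintervals $[a_i,a_{i+1}]$ are s.d. intervals. Thompson group $F$: the group of piecewise linear orientation-preserving homeomorphisms of $[0,1]$ whose slopes are powers of $2$ and whose breakpoints are dyadic rationals. If $\mathcal{I}$ ($a_0<\dots<a_n$) and $\mathcal{J}$ ($b_0<\dots<b_n$) are s.d. $n$-partitions, the map with $a_i\mapsto b_i$, linear on each $[a_i,a_{i+1}]$, is an element of $F$, said to be represented by $(\mathcal{I},\mathcal{J})$. The pair is reduced if there is no $i$ with $1\le i\le n-1$ such that both $[a_{i-1},a_{i+1}]$ and $[b_{i-1},b_{i+1}]$ are s.d. intervals; every $g\in F$ is represented by a unique reduced pair, and the leaf number of $g$ is the number $n$ of subintervals in that pair. Tree and signs: let $\mathcal{S}(\mathcal{I})$ be the set of s.d. intervals of the form $[a_i,a_j]$. The planar binary tree $F_{\mathcal{I}}$ (root edge at the top) has one edge for each element of $\mathcal{S}(\mathcal{I})$; the root edge is $[0,1]$, and each $B\in\mathcal{S}(\mathcal{I})$ that is not a subinterval of $\mathcal{I}$ ends below at a trivalent vertex from which the left half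 and the right half of $B$ descend as left and right edges; the lowermost edges (leaves) are the subintervals of $\mathcal{I}$. Edges carry signs: $[0,1]$ has sign $+$, a left edge has the same sign as its parent edge, a right edge has the opposite sign to its parent edge. Let $\sigma_{\mathcal{I}}$ be the sequence of signs of the $n$ leaves from left to right. The oriented Thompson group $\vec{F}$ consists of the $g\in F$ for which some (equivalently every) representing pair $(\mathcal{I},\mathcal{J})$ has $\sigma_{\mathcal{I}}=\sigma_{\mathcal{J}}$; such a pair is called compatible. Link: from $F_{\mathcal{I}}$ form a tangle $T_{\mathcal{I}}$ by attaching at each trivalent vertex a vertical strand going straight down to the bottom, and turning the resulting 4-valent vertex into a crossing whose under-strand is the parent edge continued into the added vertical strand and whose over-strand is the left edge joined to the right edge. It has one top endpoint and $2n-1$ bottom endpoints. Orient the arc of each edge upward if the edge has sign $+$ and downward if it has sign $-$ (the added vertical strand continues the orientation of the parent edge). Add a vertical strand on the far left and join its top to the top endpoint of $T_{\mathcal{I}}$ by a cap; orientation extended along it (so it runs downward). This gives an oriented $(0,2n)$-tangle $\widehat{T_{\mathcal{I}}}$. For a compatible pair $(\mathcal{I},\mathcal{J})$, the oriented link $L_{(\mathcal{I},\mathcal{J})}$ is obtained by placing $\widehat{T_{\mathcal{I}}}$ on top of $-\overline{\widehat{T_{\mathcal{J}}}}$ (the reflection of the planar diagram of $\widehat{T_{\mathcal{J}}}$ in a horizontal line, keeping which strand is over at each crossing, with reversed orientation) and joining the $2n$ endpoints in order. For $g\in\vec{F}$, $L_g:=L_{(\mathcal{I},\mathcal{J})}$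 with $(\mathcal{I},\mathcal{J})$ the reduced pair representing $g$. *)

theory Defs
  imports "HOL-Analysis.Analysis" "HOL-Number_Theory.Cong"
begin

section \<open>Standard dyadic partitions and Thompson's group\<close>

text \<open>A closed interval \<open>[a, b]\<close> is given by the pair \<open>(a, b)\<close> of its end points.\<close>

type_synonym interval = "real \<times> real"

definition sd_interval :: "interval \<Rightarrow> bool" where
  "sd_interval B \<longleftrightarrow>
     (\<exists>m k :: nat. k \<le> 2 ^ m - 1 \<and> B = (real k / 2 ^ m, (real k + 1) / 2 ^ m))"

text \<open>A partition \<open>0 = a\<^sub>0 < \<dots> < a\<^sub>n = 1\<close> is given by the list \<open>[a\<^sub>0, \<dots>, a\<^sub>n]\<close> of its
  \<open>n + 1\<close> breakpoints.\<close>

definition subint :: "real list \<Rightarrow> nat \<Rightarrow> interval" where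
  "subint I i = (I ! i, I ! Suc i)"

definition num_subints :: "real list \<Rightarrow> nat" where
  "num_subints I = length I - 1"

definition sd_partition :: "real list \<Rightarrow> bool" where
  "sd_partition I \<longleftrightarrow>
     2 \<le> length I \<and> sorted_wrt (<) I \<and> hd I = 0 \<and> last I = 1 \<and>
     (\<forall>i < num_subints I. sd_interval (subint I i))"

definition dyadic_rational :: "real \<Rightarrow> bool" where
  "dyadic_rational x \<longleftrightarrow> (\<exists>(k :: int) (m :: nat). x = of_int k / 2 ^ m)"

text \<open>Maps of \<open>[0, 1]\<close> are extensional functions (\<^const>\<open>undefined\<close> outside \<open>[0, 1]\<close>), so that
  equality in the type agrees with equality of maps of \<open>[0, 1]\<close>.\<close>

definition thompson_F :: "(real \<Rightarrow> real) set" where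
  "thompson_F = {g \<in> extensional {0..1}.
     (\<exists>h. homeomorphism {0..1} {0..1} g h) \<and> strict_mono_on {0..1} g \<and>
     (\<exists>xs. 2 \<le> length xs \<and> sorted_wrt (<) xs \<and> hd xs = 0 \<and> last xs = 1 \<and>
       (\<forall>x \<in> set xs. dyadic_rational x) \<and>
       (\<forall>i < length xs - 1. \<exists>(e :: int) c. \<forall>x \<in> {xs ! i .. xs ! Suc i}.
          g x = 2 powi e * x + c))}"

definition represents :: "real list \<Rightarrow> real list \<Rightarrow> (real \<Rightarrow> real) \<Rightarrow> bool" where
  "represents I J g \<longleftrightarrow>
     sd_partition I \<and> sd_partition J \<and> length I = length J \<and>
     (\<forall>i < num_subints I. \<forall>x \<in> {I ! i .. I ! Suc i}.
        g x = J ! i + (J ! Suc i - J ! i) / (I ! Suc i - I ! i) * (x - I ! i))"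

definition reduced :: "real list \<Rightarrow> real list \<Rightarrow> bool" where
  "reduced I J \<longleftrightarrow>
     \<not> (\<exists>i. 1 \<le> i \<and> i \<le> num_subints I - 1 \<and>
          sd_interval (I ! (i - 1), I ! (i + 1)) \<and> sd_interval (J ! (i - 1), J ! (i + 1)))"

definition reduced_pair :: "(real \<Rightarrow> real) \<Rightarrow> real list \<times> real list" where
  "reduced_pair g = (THE (I, J). represents I J g \<and> reduced I J)"

definition leaf_number :: "(real \<Rightarrow> real) \<Rightarrow> nat" where
  "leaf_number g = num_subints (fst (reduced_pair g))"


section \<open>The signed binary tree of a partition\<close>

definition tree_edges :: "real list \<Rightarrow> interval set" where
  "tree_edges I = {(I ! i, I ! j) | i j. i < j \<and> j < length I \<and> sd_interval (I ! i, I ! j)}"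

definition tree_leaves :: "real list \<Rightarrow> interval set" where
  "tree_leaves I = {subint I i | i. i < num_subints I}"

text \<open>A trivalent vertex is identified with the edge \<open>B\<close> that ends at it from above.\<close>

definition tree_vertices :: "real list \<Rightarrow> interval set" where
  "tree_vertices I = tree_edges I - tree_leaves I"

definition mid :: "interval \<Rightarrow> real" where
  "mid B = (fst B + snd B) / 2"

definition left_half :: "interval \<Rightarrow> interval" where
  "left_half B = (fst B, mid B)"

definition right_half :: "interval \<Rightarrow> interval" where
  "right_half B = (mid B, snd B)"

datatype esign = Plus | Minus

fun opp :: "esign \<Rightarrow> esign" where
  "opp Plus = Minus"
| "opp Minus = Plus"

inductive has_sign :: "real list \<Rightarrow> interval \<Rightarrow> esign \<Rightarrow> bool" for I where
  root: "has_sign I (0, 1) Plus"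
| left: "has_sign I B s \<Longrightarrow> B \<in> tree_vertices I \<Longrightarrow> has_sign I (left_half B) s"
| right: "has_sign I B s \<Longrightarrow> B \<in> tree_vertices I \<Longrightarrow> has_sign I (right_half B) (opp s)"

definition edge_sign :: "real list \<Rightarrow> interval \<Rightarrow> esign" where
  "edge_sign I B = (THE s. has_sign I B s)"

definition leaf_signs :: "real list \<Rightarrow> esign list" where
  "leaf_signs I = map (\<lambda>i. edge_sign I (subint I i)) [0..<num_subints I]"

definition compatible :: "real list \<Rightarrow> real list \<Rightarrow> bool" where
  "compatible I J \<longleftrightarrow> leaf_signs I = leaf_signs J"

definition oriented_thompson_F :: "(real \<Rightarrow> real) set" where
  "oriented_thompson_F = {g \<in> thompson_F. \<exists>I J. represents I J g \<and> compatible I J}"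


section \<open>Oriented tangle diagrams\<close>

text \<open>A diagram consists of arcs that run monotonically in the vertical direction, each with an
  upper and a lower end. Arc ends meet in fours at crossings and in pairs at joins; the
  remaining ends are the end points at the top and at the bottom, listed from left to right.
  A crossing \<open>(p, q, r, s)\<close> lists its four arc ends in counterclockwise order, such that the
  under-strand passes from \<open>p\<close> to \<open>r\<close> or back, and the over-strand from \<open>q\<close> to \<open>s\<close> or back.
  The arcs in the field \<open>upward\<close> are oriented upward, all others downward.\<close>

datatype 'a arc_end = Upper (arc_of: 'a) | Lower (arc_of: 'a)

type_synonym 'a crossing = "'a arc_end \<times> 'a arc_end \<times> 'a arc_end \<times> 'a arc_end"

record 'a tangle =
  arcs :: "'a set"
  crossings :: "'a crossing set"
  joins :: "('a arc_end \<times> 'a arc_end) set"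
  upward :: "'a set"
  top_ends :: "'a arc_end list"
  bottom_ends :: "'a arc_end list"

fun swap_end :: "'a arc_end \<Rightarrow> 'a arc_end" where
  "swap_end (Upper a) = Lower a"
| "swap_end (Lower a) = Upper a"

text \<open>Reflection of the planar diagram in a horizontal line. Over- and under-strands are kept,
  while the cyclic order at a crossing is reversed.\<close>

definition tangle_reflect :: "'a tangle \<Rightarrow> 'a tangle" where
  "tangle_reflect T =
     \<lparr> arcs = arcs T,
       crossings = (\<lambda>(p, q, r, s). (swap_end p, swap_end s, swap_end r, swap_end q)) ` crossings T,
       joins = map_prod swap_end swap_end ` joins T,
       upward = arcs T - upward T,
       top_ends = map swap_end (bottom_ends T),
       bottom_ends = map swap_end (top_ends T) \<rparr>"

definition tangle_reverse :: "'a tangle \<Rightarrow> 'a tangle" where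
  "tangle_reverse T = T\<lparr> upward := arcs T - upward T \<rparr>"

definition tangle_relabel :: "('a \<Rightarrow> 'b) \<Rightarrow> 'a tangle \<Rightarrow> 'b tangle" where
  "tangle_relabel f T =
     (let h = map_arc_end f in
     \<lparr> arcs = f ` arcs T,
       crossings = (\<lambda>(p, q, r, s). (h p, h q, h r, h s)) ` crossings T,
       joins = map_prod h h ` joins T,
       upward = f ` upward T,
       top_ends = map h (top_ends T),
       bottom_ends = map h (bottom_ends T) \<rparr>)"

text \<open>The tangle \<open>S\<close> on top of the tangle \<open>T\<close>, the bottom end points of \<open>S\<close> being joined in order
  to the top end points of \<open>T\<close>.\<close>

definition tangle_stack :: "'a tangle \<Rightarrow> 'b tangle \<Rightarrow> ('a + 'b) tangle" where
  "tangle_stack S T =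
     (let S' = tangle_relabel Inl S; T' = tangle_relabel Inr T in
     \<lparr> arcs = arcs S' \<union> arcs T',
       crossings = crossings S' \<union> crossings T',
       joins = joins S' \<union> joins T' \<union> set (zip (bottom_ends S') (top_ends T')),
       upward = upward S' \<union> upward T',
       top_ends = top_ends S',
       bottom_ends = bottom_ends T' \<rparr>)"

text \<open>The components of a link diagram are traced out by passing straight through crossings,
  so they correspond to the classes of arcs under the equivalence relation generated by
  consecutiveness.\<close>

definition consecutive :: "'a tangle \<Rightarrow> ('a \<times> 'a) set" where
  "consecutive T =
     {(arc_of p, arc_of r) | p q r s. (p, q, r, s) \<in> crossings T} \<union>
     {(arc_of q, arc_of s) | p q r s. (p, q, r, s) \<in> crossings T} \<union>
     {(arc_of p, arc_of q) | p q. (p, q) \<in> joins T}"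

definition same_component :: "'a tangle \<Rightarrow> ('a \<times> 'a) set" where
  "same_component T =
     {(a, b) \<in> arcs T \<times> arcs T. (a, b) \<in> (consecutive T \<union> (consecutive T)\<inverse>)\<^sup>*}"

definition link_components :: "'a tangle \<Rightarrow> 'a set set" where
  "link_components T = arcs T // same_component T"


section \<open>The oriented Thompson link\<close>

text \<open>The arcs are the edges of the tree, the vertical strands attached at its vertices, and the
  strand added on the far left.\<close>

datatype tree_arc = Edge interval | Vert interval | FarLeft

text \<open>The vertical strand attached at a vertex \<open>B\<close> separates the leaves to the left of the
  midpoint of \<open>B\<close> from those to the right of it. So the strand between two adjacent
  leaves comes from the vertex whose midpoint is their common breakpoint.\<close>

definition vertex_at :: "real list \<Rightarrow> real \<Rightarrow> interval" where
  "vertex_at I x = (THE B. B \<in> tree_vertices I \<and> mid B = x)"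

definition tree_tangle :: "real list \<Rightarrow> tree_arc tangle" where
  "tree_tangle I =
     \<lparr> arcs = Edge ` tree_edges I \<union> Vert ` tree_vertices I,
       crossings =
         (\<lambda>B. (Lower (Edge B), Upper (Edge (left_half B)), Upper (Vert B), Upper (Edge (right_half B))))
           ` tree_vertices I,
       joins = {},
       upward = Edge ` {B \<in> tree_edges I. edge_sign I B = Plus} \<union>
                Vert ` {B \<in> tree_vertices I. edge_sign I B = Plus},
       top_ends = [Upper (Edge (0, 1))],
       bottom_ends = Lower (Edge (subint I 0)) #
         concat (map (\<lambda>i. [Lower (Vert (vertex_at I (I ! i))), Lower (Edge (subint I i))])
           [1..<num_subints I]) \<rparr>"

text \<open>The tangle with the strand \<^const>\<open>FarLeft\<close> added, which is oriented downward.\<close>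

definition capped_tree_tangle :: "real list \<Rightarrow> tree_arc tangle" where
  "capped_tree_tangle I = (let T = tree_tangle I in
     T\<lparr> arcs := insert FarLeft (arcs T),
        joins := insert (Upper FarLeft, hd (top_ends T)) (joins T),
        top_ends := [],
        bottom_ends := Lower FarLeft # bottom_ends T \<rparr>)"

definition pair_link :: "real list \<Rightarrow> real list \<Rightarrow> (tree_arc + tree_arc) tangle" where
  "pair_link I J = tangle_stack (capped_tree_tangle I)
     (tangle_reverse (tangle_reflect (capped_tree_tangle J)))"

definition thompson_link :: "(real \<Rightarrow> real) \<Rightarrow> (tree_arc + tree_arc) tangle" where
  "thompson_link g = (case reduced_pair g of (I, J) \<Rightarrow> pair_link I J)"

end

theory Submission imports Defs "HOL-Combinatorics.Permutations" begin

text \<open>Following the orientation permutes the arcs of the link diagram, and the components of the link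
  are the cycles of this permutation. The oriented smoothing of a crossing composes the permutation
  with a transposition. Since the parity of a permutation is the parity of the number of points
  minus the number of cycles, and there are \<open>2 (n - 1)\<close> crossings, the link has as many components
  modulo 2 as the fully smoothed diagram. At every vertex the smoothing joins the parent edge to
  the left edge and the vertical strand to the right edge, whatever the sign. So in both trees leaf
  \<open>i\<close> is joined to the vertical strand on its left (leaf \<open>0\<close> to the strand on the far left), and the
  smoothed diagram consists of exactly \<open>n\<close> circles, one for each leaf.\<close>

section \<open>Cycles and parity of permutations\<close>

text \<open>Signs of permutations need an orientation: without one, consecutiveness is only a
  symmetric relation and no arc has a next arc. Compatibility makes the orientations of the two
  trees agree along the middle line, because a leaf sign also fixes the sign of the vertical strand
  to its left, which is the opposite one. A crossing contributes a transposition because its two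
  arriving arcs exchange the arcs along which they continue. Different crossings move different
  arcs, so all these transpositions together form an involution with an even number of swapped
  pairs. A second difficulty is that the link is defined through the reduced pair, while membership
  in the oriented group provides only some compatible pair. Removing a common caret deletes the same
  entry from both sign sequences, so compatibility survives the reduction, and uniqueness of the
  reduced pair identifies the outcome with \<open>reduced_pair g\<close>.\<close>

definition component_count :: "'a set \<Rightarrow> ('a \<times> 'a) set \<Rightarrow> nat" where
  "component_count X r = card (X // {(a, b) \<in> X \<times> X. (a, b) \<in> (r \<union> r\<inverse>)\<^sup>*})"

lemma symclosure_rtrancl_sym: "(a, b) \<in> (r \<union> r\<inverse>)\<^sup>* \<Longrightarrow> (b, a) \<in> (r \<union> r\<inverse>)\<^sup>*"
  by (metis converse_Un converse_converse rtrancl_converseI sup_commute)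

lemma symclosure_rtrancl_invariant:
  assumes "\<And>a b. (a, b) \<in> r \<Longrightarrow> f a = f b" and "(a, b) \<in> (r \<union> r\<inverse>)\<^sup>*"
  shows "f a = f b"
  using assms(2) by induction (auto dest: assms(1))

text \<open>The components are the fibres of a complete invariant: \<open>inv\<close> keeps
  \<open>f\<close> constant along paths, and \<open>conn\<close> connects points of equal
  value.\<close>

lemma component_count_eq_card_image:
  assumes inv: "\<And>a b. (a, b) \<in> r \<Longrightarrow> f a = f b"
    and conn: "\<And>a b. a \<in> X \<Longrightarrow> b \<in> X \<Longrightarrow> f a = f b \<Longrightarrow> (a, b) \<in> (r \<union> r\<inverse>)\<^sup>*"
  shows "component_count X r = card (f ` X)"
proof -
  let ?R = "{(a, b) \<in> X \<times> X. (a, b) \<in> (r \<union> r\<inverse>)\<^sup>*}"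
  have cls: "?R `` {a} = {b \<in> X. f b = f a}" if "a \<in> X" for a
    using that conn symclosure_rtrancl_invariant[OF inv] by fastforce
  have "X // ?R = (\<lambda>y. {b \<in> X. f b = y}) ` f ` X"
    unfolding quotient_def using cls by auto
  moreover have "inj_on (\<lambda>y. {b \<in> X. f b = y}) (f ` X)"
    by (rule inj_onI) auto
  ultimately show ?thesis
    unfolding component_count_def by (simp add: card_image)
qed

text \<open>Removing a point \<open>x\<close> from its cycle is composition with one transposition; it leaves the
  number of cycles unchanged unless \<open>x\<close> is a fixed point.\<close>

theorem evenperm_iff_component_count:
  assumes "finite S" and "p permutes S"
  shows "evenperm p \<longleftrightarrow> even (card S + component_count S {(x, p x) |x. x \<in> S})"
  using assms
proof (induction S arbitrary: p rule: finite_induct)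
  case empty
  then have "p = id" by simp
  then show ?case by (simp add: component_count_def)
next
  case (insert x S)
  \<comment> \<open>\<open>q\<close> short-cuts the cycle of \<open>p\<close> at \<open>x\<close>:
    it fixes \<open>x\<close> and sends the predecessor of \<open>x\<close> to
    \<open>p x\<close>.\<close>
  define q where "q = Transposition.transpose x (p x) \<circ> p"
  have q: "q permutes S"
    unfolding q_def by (rule permutes_insert_lemma) (rule insert.prems)
  let ?rp = "{(y, p y) |y. y \<in> insert x S}" and ?rq = "{(y, q y) |y. y \<in> S}"
  define cl where "cl y = (?rq \<union> ?rq\<inverse>)\<^sup>* `` {y}" for y
  have cl_iff: "cl a = cl b \<longleftrightarrow> (a, b) \<in> (?rq \<union> ?rq\<inverse>)\<^sup>*" for a b
  proof
    assume "cl a = cl b"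
    moreover have "b \<in> cl b" unfolding cl_def by auto
    ultimately show "(a, b) \<in> (?rq \<union> ?rq\<inverse>)\<^sup>*" unfolding cl_def by auto
  next
    assume "(a, b) \<in> (?rq \<union> ?rq\<inverse>)\<^sup>*"
    then show "cl a = cl b"
      unfolding cl_def by (auto intro: rtrancl_trans dest: symclosure_rtrancl_sym)
  qed
  have cl_q: "cl (q y) = cl y" if "y \<in> S" for y
    unfolding cl_iff using that by (intro r_into_rtrancl) auto
  have count_q: "component_count S ?rq = card (cl ` S)"
    by (rule component_count_eq_card_image) (use cl_q cl_iff in auto)
  have IH: "evenperm q \<longleftrightarrow> even (card S + component_count S ?rq)"
    by (rule insert.IH) (rule q)
  have p_in: "p y \<in> insert x S" if "y \<in> insert x S" for y
    using insert.prems that by (meson permutes_in_image)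
  have p_inj: "p a = p b \<Longrightarrow> a = b" for a b
    using insert.prems by (metis permutes_inj injD)
  show ?case
  proof (cases "p x = x")
    case True
    then have qp: "q = p" by (simp add: q_def)
    \<comment> \<open>The fixed point is a component of its own; the value \<open>None\<close> keeps
      it apart from the classes of \<open>q\<close>.\<close>
    define f where "f y = (if y = x then None else Some (cl y))" for y
    have lift: "(a, b) \<in> (?rp \<union> ?rp\<inverse>)\<^sup>*" if "(a, b) \<in> (?rq \<union> ?rq\<inverse>)\<^sup>*" for a b
      by (rule subsetD[OF rtrancl_mono that]) (auto simp: qp)
    have "component_count (insert x S) ?rp = card (f ` insert x S)"
    proof (rule component_count_eq_card_image)
      fix a b assume "(a, b) \<in> ?rp"
      then show "f a = f b"
        using True p_inj[of a x] cl_q[of a] by (auto simp: f_def qp)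
    next
      fix a b assume "a \<in> insert x S" "b \<in> insert x S" "f a = f b"
      then show "(a, b) \<in> (?rp \<union> ?rp\<inverse>)\<^sup>*"
        using lift cl_iff by (auto simp: f_def split: if_splits)
    qed
    also have "f ` insert x S = insert None (Some ` cl ` S)"
      using insert.hyps by (auto simp: f_def)
    also have "card \<dots> = Suc (card (cl ` S))"
      using insert.hyps by (simp add: card_image)
    finally show ?thesis
      using IH count_q insert.hyps by (simp add: qp)
  next
    case False
    have px: "p x \<in> S" using p_in[of x] False by auto
    \<comment> \<open>Inserting \<open>x\<close> only lengthens the cycle through
      \<open>p x\<close>, so \<open>x\<close> takes the class of \<open>p x\<close> and the number
      of classes stays the same.\<close>
    define f where "f y = cl (if y = x then p x else y)" for y
    have q_eq: "q y = (if p y = x then p x else p y)" if "y \<in> S" for y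
      using that insert.hyps p_inj[of y x] by (auto simp: q_def Transposition.transpose_def)
    have step: "(y, q y) \<in> (?rp \<union> ?rp\<inverse>)\<^sup>*" if "y \<in> S" for y
    proof -
      have 1: "(y, p y) \<in> (?rp \<union> ?rp\<inverse>)\<^sup>*" and 2: "(x, p x) \<in> (?rp \<union> ?rp\<inverse>)\<^sup>*"
        using that by auto
      show ?thesis
        unfolding q_eq[OF that] using 1 rtrancl_trans[OF 1, of "p x"] 2 by auto
    qed
    have lift: "(a, b) \<in> (?rp \<union> ?rp\<inverse>)\<^sup>*" if "(a, b) \<in> (?rq \<union> ?rq\<inverse>)\<^sup>*" for a b
      using that
    proof induction
      case (step b c)
      then have "(b, c) \<in> (?rp \<union> ?rp\<inverse>)\<^sup>*"
        using \<open>\<And>y. y \<in> S \<Longrightarrow> (y, q y) \<in> (?rp \<union> ?rp\<inverse>)\<^sup>*\<close> symclosure_rtrancl_sym[of _ _ ?rp]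
        by blast
      with step.IH show ?case by (rule rtrancl_trans)
    qed simp
    have xpx: "(x, p x) \<in> (?rp \<union> ?rp\<inverse>)\<^sup>*" by auto
    have "component_count (insert x S) ?rp = card (f ` insert x S)"
    proof (rule component_count_eq_card_image)
      fix a b assume "(a, b) \<in> ?rp"
      then have ab: "b = p a" "a = x \<or> a \<noteq> x \<and> a \<in> S" by auto
      from ab(2) show "f a = f b"
      proof
        assume "a = x"
        then show ?thesis using False by (simp add: f_def ab(1))
      next
        assume a: "a \<noteq> x \<and> a \<in> S"
        then have "f b = cl (q a)" by (simp add: f_def ab(1) q_eq)
        with a show ?thesis by (simp add: f_def cl_q)
      qed
    next
      fix a b assume ab: "a \<in> insert x S" "b \<in> insert x S" "f a = f b"
      let ?\<rho> = "\<lambda>y. if y = x then p x else y"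
      have "(?\<rho> a, ?\<rho> b) \<in> (?rp \<union> ?rp\<inverse>)\<^sup>*"
        using ab(3) lift cl_iff unfolding f_def by blast
      moreover have \<rho>: "(y, ?\<rho> y) \<in> (?rp \<union> ?rp\<inverse>)\<^sup>*" for y
        using xpx by (cases "y = x") simp_all
      ultimately have "(a, ?\<rho> b) \<in> (?rp \<union> ?rp\<inverse>)\<^sup>*" by (rule rtrancl_trans[rotated])
      with symclosure_rtrancl_sym[OF \<rho>[of b]] show "(a, b) \<in> (?rp \<union> ?rp\<inverse>)\<^sup>*"
        by (rule rtrancl_trans[rotated])
    qed
    also have "f ` insert x S = cl ` S"
    proof -
      have "f ` S = cl ` S" using insert.hyps by (intro image_cong) (auto simp: f_def)
      moreover have "f x \<in> cl ` S" using px by (simp add: f_def)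
      ultimately show ?thesis by auto
    qed
    finally have count: "component_count (insert x S) ?rp = card (cl ` S)" .
    have "p = Transposition.transpose x (p x) \<circ> q"
      by (simp add: q_def fun_eq_iff)
    moreover have "evenperm (Transposition.transpose x (p x) \<circ> q) \<longleftrightarrow> \<not> evenperm q"
    proof (subst evenperm_comp)
      show "permutation q" unfolding permutation_permutes using q insert.hyps(1) by blast
    qed (use False in \<open>auto simp: evenperm_swap permutation_swap_id\<close>)
    ultimately have "evenperm p \<longleftrightarrow> \<not> evenperm q" by metis
    then show ?thesis
      using IH insert.hyps count count_q by simp
  qed
qed

text \<open>The permutation is a product of \<open>card C\<close> transpositions, one for each pair
  \<open>f c\<close>, \<open>g c\<close>. Injectivity and disjoint images keep the pairs apart, so
  no factor disturbs another.\<close>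

lemma ex_swapping_permutation:
  assumes "finite C" and "inj_on f C" and "inj_on g C" and "f ` C \<inter> g ` C = {}"
  shows "\<exists>\<tau>. \<tau> permutes (f ` C \<union> g ` C) \<and> (\<forall>c \<in> C. \<tau> (f c) = g c \<and> \<tau> (g c) = f c) \<and>
     (evenperm \<tau> \<longleftrightarrow> even (card C))"
  using assms
proof (induction C rule: finite_induct)
  case empty
  then show ?case by (intro exI[of _ id]) auto
next
  case (insert c C)
  obtain \<tau> where \<tau>: "\<tau> permutes (f ` C \<union> g ` C)"
    "\<And>c. c \<in> C \<Longrightarrow> \<tau> (f c) = g c \<and> \<tau> (g c) = f c" "evenperm \<tau> \<longleftrightarrow> even (card C)"
    using insert by (auto simp: inj_on_insert)
  have new: "f c \<notin> f ` C \<union> g ` C" "g c \<notin> f ` C \<union> g ` C" "f c \<noteq> g c"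
    using insert.prems insert.hyps by auto
  then have fixed: "\<tau> (f c) = f c" "\<tau> (g c) = g c"
    using \<tau>(1) by (auto simp: permutes_not_in)
  let ?\<tau> = "\<tau> \<circ> Transposition.transpose (f c) (g c)"
  have "?\<tau> permutes (f ` insert c C \<union> g ` insert c C)"
    by (rule permutes_compose[OF permutes_swap_id permutes_subset[OF \<tau>(1)]]) auto
  moreover have "?\<tau> (f d) = g d \<and> ?\<tau> (g d) = f d" if "d \<in> insert c C" for d
  proof (cases "d = c")
    case False
    then have "d \<in> C" using that by auto
    then have "f d \<noteq> f c" "f d \<noteq> g c" "g d \<noteq> f c" "g d \<noteq> g c" using new by (metis UnCI imageI)+
    then show ?thesis using \<tau>(2)[OF \<open>d \<in> C\<close>] by (simp add: Transposition.transpose_def)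
  qed (simp add: fixed)
  moreover have "evenperm ?\<tau> \<longleftrightarrow> \<not> evenperm \<tau>"
  proof (subst evenperm_comp)
    have "finite (f ` C \<union> g ` C)" using insert.hyps(1) by simp
    with \<tau>(1) show "permutation \<tau>" unfolding permutation_permutes by (intro exI conjI)
  qed (use new in \<open>auto simp: evenperm_swap permutation_swap_id\<close>)
  moreover have "even (card (insert c C)) \<longleftrightarrow> \<not> even (card C)"
    using insert.hyps by simp
  ultimately show ?case using \<tau>(3) by (intro exI[of _ ?\<tau>]) blast
qed

text \<open>Think of \<open>K\<close> as junctions, of \<open>a k\<close> as the arc arriving at
  \<open>k\<close> and of \<open>b k\<close> as the arc leaving it. Rerouting by \<open>s\<close>
  precomposes the permutation taking \<open>a k\<close> to \<open>b k\<close> with the involution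
  that exchanges \<open>a (f c)\<close> and \<open>a (g c)\<close>. Its sign is given by
  \<open>card C\<close>, while \<open>card X\<close> enters both counts and cancels modulo
  2.\<close>

lemma component_count_swap_parity:
  assumes X: "finite X" "bij_betw a K X" "bij_betw b K X"
    and C: "finite C" "inj_on f C" "inj_on g C" "f ` C \<inter> g ` C = {}" "f ` C \<subseteq> K" "g ` C \<subseteq> K"
    and s: "\<And>c. c \<in> C \<Longrightarrow> s (f c) = g c" "\<And>c. c \<in> C \<Longrightarrow> s (g c) = f c"
      "\<And>k. k \<in> K \<Longrightarrow> k \<notin> f ` C \<union> g ` C \<Longrightarrow> s k = k"
  shows "even (component_count X {(a k, b k) |k. k \<in> K} +
    component_count X {(a k, b (s k)) |k. k \<in> K} + card C)"
proof -
  define p where "p x = (if x \<in> X then b (inv_into K a x) else x)" for x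
  have inj: "inj_on a K" and img: "a ` K = X" using X(2) unfolding bij_betw_def by auto
  have "bij_betw (b \<circ> inv_into K a) X X"
    using bij_betw_trans[OF bij_betw_inv_into[OF X(2)] X(3)] .
  then have "bij_betw p X X" by (rule bij_betw_cong[THEN iffD1, rotated]) (simp add: p_def)
  then have p: "p permutes X" by (rule bij_imp_permutes) (simp add: p_def)
  have p_a: "p (a k) = b k" if "k \<in> K" for k
    using that inj img by (auto simp: p_def)
  have inj': "inj_on (a \<circ> f) C" "inj_on (a \<circ> g) C"
    using C inj by (auto intro!: comp_inj_on intro: inj_on_subset)
  have disj: "(a \<circ> f) ` C \<inter> (a \<circ> g) ` C = {}"
  proof -
    have "a ` (f ` C) \<inter> a ` (g ` C) = a ` (f ` C \<inter> g ` C)"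
      by (rule inj_on_image_Int[OF inj C(5,6), symmetric])
    then show ?thesis using C(4) by (simp add: image_comp)
  qed
  obtain \<tau> where \<tau>: "\<tau> permutes ((a \<circ> f) ` C \<union> (a \<circ> g) ` C)"
    "\<And>c. c \<in> C \<Longrightarrow> \<tau> (a (f c)) = a (g c) \<and> \<tau> (a (g c)) = a (f c)" "evenperm \<tau> \<longleftrightarrow> even (card C)"
    using ex_swapping_permutation[OF C(1) inj' disj] by auto
  have \<tau>X: "\<tau> permutes X"
    by (rule permutes_subset[OF \<tau>(1)]) (use C img in auto)
  have s_K: "s k \<in> K" and \<tau>_a: "\<tau> (a k) = a (s k)" if k: "k \<in> K" for k
  proof -
    consider c where "c \<in> C" "k = f c" | c where "c \<in> C" "k = g c" | "k \<notin> f ` C \<union> g ` C"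
      by blast
    then have "s k \<in> K \<and> \<tau> (a k) = a (s k)"
    proof cases
      case 3
      then have "a k \<notin> (a \<circ> f) ` C \<union> (a \<circ> g) ` C"
        using inj k C(5,6) by (auto dest: inj_onD)
      then show ?thesis using \<tau>(1) 3 s(3) k by (simp add: permutes_not_in)
    qed (use s \<tau>(2) C(5,6) in auto)
    then show "s k \<in> K" "\<tau> (a k) = a (s k)" by auto
  qed
  have eq: "{(x, p x) |x. x \<in> X} = {(a k, b k) |k. k \<in> K}"
    unfolding img[symmetric] using p_a by force
  have eq': "{(x, (p \<circ> \<tau>) x) |x. x \<in> X} = {(a k, b (s k)) |k. k \<in> K}"
    unfolding img[symmetric] using p_a \<tau>_a s_K by force
  have "evenperm (p \<circ> \<tau>) \<longleftrightarrow> evenperm p = evenperm \<tau>"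
    using p \<tau>X X(1) permutation_permutes by (intro evenperm_comp) blast+
  then show ?thesis
    using evenperm_iff_component_count[OF X(1) p, unfolded eq]
      evenperm_iff_component_count[OF X(1) permutes_compose[OF \<tau>X p], unfolded eq'] \<tau>(3)
    unfolding even_add by blast
qed

section \<open>Standard dyadic intervals\<close>

lemma sd_intervalE:
  assumes "sd_interval (a, b)"
  obtains m k :: nat where "k < 2 ^ m" "a = real k / 2 ^ m" "b = (real k + 1) / 2 ^ m"
proof -
  obtain m k :: nat where "k \<le> 2 ^ m - 1" "(a, b) = (real k / 2 ^ m, (real k + 1) / 2 ^ m)"
    using assms unfolding sd_interval_def by blast
  moreover from this have "k < 2 ^ m" by (simp add: less_eq_Suc_le le_diff_conv2)
  ultimately show ?thesis using that[of k m] by simp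
qed

lemma sd_intervalI:
  "k < 2 ^ m \<Longrightarrow> a = real k / 2 ^ m \<Longrightarrow> b = (real k + 1) / 2 ^ m \<Longrightarrow> sd_interval (a, b)"
  unfolding sd_interval_def by (intro exI[of _ m] exI[of _ k]) auto

lemma sd_interval_unit: "sd_interval (0, 1)"
  by (rule sd_intervalI[of 0 0]) auto

lemma sd_interval_bounds:
  assumes "sd_interval (a, b)"
  shows "0 \<le> a" "a < b" "b \<le> 1"
proof -
  obtain m k :: nat where mk: "k < 2 ^ m" "a = real k / 2 ^ m" "b = (real k + 1) / 2 ^ m"
    using assms by (rule sd_intervalE)
  from mk(1) have "real (Suc k) \<le> real (2 ^ m)" by (subst of_nat_le_iff) simp
  then show "0 \<le> a" "a < b" "b \<le> 1" unfolding mk by (simp_all add: divide_strict_right_mono)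
qed

text \<open>Clearing denominators turns overlap into strict inequalities between integers, and these
  sharpen to containment of the finer cell in the coarser one.\<close>

lemma dyadic_subinterval:
  fixes k l m e :: nat
  assumes "real k / 2 ^ m < (real l + 1) / 2 ^ (m + e)"
    and "real l / 2 ^ (m + e) < (real k + 1) / 2 ^ m"
  shows "k * 2 ^ e \<le> l" "l + 1 \<le> (k + 1) * 2 ^ e"
proof -
  have "real k * 2 ^ e < real l + 1" "real l < (real k + 1) * 2 ^ e"
    using assms by (simp_all add: power_add field_simps)
  then have "real (k * 2 ^ e) < real (l + 1)" "real l < real ((k + 1) * 2 ^ e)"
    by (simp_all add: algebra_simps)
  then show "k * 2 ^ e \<le> l" "l + 1 \<le> (k + 1) * 2 ^ e"
    unfolding of_nat_less_iff by simp_all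
qed

lemma dyadic_subinterval_le:
  fixes k l m e :: nat
  assumes "k * 2 ^ e \<le> l" "l + 1 \<le> (k + 1) * 2 ^ e"
  shows "real k / 2 ^ m \<le> real l / 2 ^ (m + e)"
    and "(real l + 1) / 2 ^ (m + e) \<le> (real k + 1) / 2 ^ m"
proof -
  have "real (k * 2 ^ e) \<le> real l" "real (l + 1) \<le> real ((k + 1) * 2 ^ e)"
    using assms by (simp_all only: of_nat_le_iff)
  then have "real k * 2 ^ e / 2 ^ (m + e) \<le> real l / 2 ^ (m + e)"
    "(real l + 1) / 2 ^ (m + e) \<le> (real k + 1) * 2 ^ e / 2 ^ (m + e)"
    by (auto intro!: divide_right_mono simp: algebra_simps)
  then show "real k / 2 ^ m \<le> real l / 2 ^ (m + e)"
    "(real l + 1) / 2 ^ (m + e) \<le> (real k + 1) / 2 ^ m"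
    by (simp_all add: power_add)
qed

text \<open>The grid with the larger exponent refines the other, so once the interiors meet
  (\<open>a < d\<close> and \<open>c < b\<close>), the finer cell lies in the coarser one.\<close>

lemma sd_interval_nested:
  assumes "sd_interval (a, b)" "sd_interval (c, d)" "a < d" "c < b"
  shows "a \<le> c \<and> d \<le> b \<or> c \<le> a \<and> b \<le> d"
proof -
  obtain m k :: nat where mk: "k < 2 ^ m" "a = real k / 2 ^ m" "b = (real k + 1) / 2 ^ m"
    using assms(1) by (rule sd_intervalE)
  obtain p l :: nat where pl: "l < 2 ^ p" "c = real l / 2 ^ p" "d = (real l + 1) / 2 ^ p"
    using assms(2) by (rule sd_intervalE)
  show ?thesis
  proof (cases "m \<le> p")
    case True
    then obtain e where e: "p = m + e" using le_Suc_ex by blast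
    have "a \<le> c \<and> d \<le> b"
      using assms dyadic_subinterval[of k m l e] dyadic_subinterval_le[of k e l m]
      unfolding mk pl e by blast
    then show ?thesis ..
  next
    case False
    then obtain e where e: "m = p + e" using le_Suc_ex nat_le_linear by blast
    have "c \<le> a \<and> b \<le> d"
      using assms dyadic_subinterval[of l p k e] dyadic_subinterval_le[of l e k p]
      unfolding mk pl e by blast
    then show ?thesis ..
  qed
qed

lemma sd_interval_halves:
  assumes "sd_interval B"
  shows "sd_interval (left_half B)" "sd_interval (right_half B)"
proof -
  obtain a b where B: "B = (a, b)" by (cases B)
  obtain m k :: nat where mk: "k < 2 ^ m" "a = real k / 2 ^ m" "b = (real k + 1) / 2 ^ m"
    using assms unfolding B by (rule sd_intervalE)
  show "sd_interval (left_half B)" unfolding left_half_def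
    by (rule sd_intervalI[of "2 * k" "Suc m"]) (use mk in \<open>auto simp: B mid_def field_simps\<close>)
  show "sd_interval (right_half B)" unfolding right_half_def
    by (rule sd_intervalI[of "2 * k + 1" "Suc m"]) (use mk in \<open>auto simp: B mid_def field_simps\<close>)
qed

lemma sd_interval_parent:
  assumes "sd_interval B" "B \<noteq> (0, 1)"
  obtains P where "sd_interval P" "B = left_half P \<or> B = right_half P"
proof -
  obtain a b where B: "B = (a, b)" by (cases B)
  obtain m k :: nat where mk: "k < 2 ^ m" "a = real k / 2 ^ m" "b = (real k + 1) / 2 ^ m"
    using assms unfolding B by (auto elim: sd_intervalE)
  have "m \<noteq> 0" using assms(2) mk by (auto simp: B intro: ccontr)
  then obtain p where p: "m = Suc p" by (cases m) auto
  \<comment> \<open>Halving \<open>k\<close> drops its last binary digit, and that digit tells which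
    half of \<open>?P\<close> is \<open>B\<close>.\<close>
  let ?P = "(real (k div 2) / 2 ^ p, (real (k div 2) + 1) / 2 ^ p)"
  have "sd_interval ?P" by (rule sd_intervalI[of "k div 2" p]) (use mk p in auto)
  moreover have "B = left_half ?P \<or> B = right_half ?P"
  proof (cases "even k")
    case True
    then obtain l where "k = 2 * l" by auto
    then have "B = left_half ?P" using mk p by (auto simp: B left_half_def mid_def field_simps)
    then show ?thesis ..
  next
    case False
    then obtain l where "k = 2 * l + 1" by (auto elim: oddE)
    then have "B = right_half ?P" using mk p by (auto simp: B right_half_def mid_def field_simps)
    then show ?thesis ..
  qed
  ultimately show ?thesis by (rule that)
qed

text \<open>An interval reaching across the midpoint would overlap both halves of
  \<open>(a, b)\<close> and, by nesting, contain both.\<close>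

lemma sd_interval_strict_sub:
  assumes "sd_interval (a, b)" "sd_interval (c, d)" "a \<le> c" "d \<le> b" "(c, d) \<noteq> (a, b)"
  shows "d \<le> mid (a, b) \<or> mid (a, b) \<le> c"
proof (rule ccontr)
  assume "\<not> ?thesis"
  then have cd: "c < mid (a, b)" "mid (a, b) < d" by auto
  have "a < b" using sd_interval_bounds[OF assms(1)] by simp
  then have "a < mid (a, b)" "mid (a, b) < b" by (auto simp: mid_def)
  then have "c \<le> a" "b \<le> d"
    using sd_interval_nested[of a "mid (a, b)" c d] sd_interval_nested[of "mid (a, b)" b c d]
      sd_interval_halves[OF assms(1)] assms cd by (auto simp: left_half_def right_half_def)
  then show False using assms by auto
qed

lemma left_half_inject: "left_half A = left_half B \<longleftrightarrow> A = B"
  by (cases A; cases B) (auto simp: left_half_def mid_def)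

lemma right_half_inject: "right_half A = right_half B \<longleftrightarrow> A = B"
  by (cases A; cases B) (auto simp: right_half_def mid_def)

lemma mid_less:
  assumes "sd_interval B"
  shows "fst B < mid B" "mid B < snd B"
  using sd_interval_bounds[of "fst B" "snd B"] assms by (auto simp: mid_def)

text \<open>If they were equal, \<open>A\<close> would start inside \<open>B\<close> and end beyond
  it, so the two would overlap without being nested.\<close>

lemma left_half_neq_right_half:
  assumes "sd_interval A" "sd_interval B"
  shows "left_half A \<noteq> right_half B"
proof
  assume eq: "left_half A = right_half B"
  obtain a b c d where AB: "A = (a, b)" "B = (c, d)" by (cases A; cases B)
  have ab: "a < b" "c < d" using assms sd_interval_bounds unfolding AB by auto
  have 1: "a = (c + d) / 2" "(a + b) / 2 = d"
    using eq by (auto simp: AB left_half_def right_half_def mid_def)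
  then have 2: "a < d" "c < a" "d < b" using ab by auto
  then show False using sd_interval_nested[of a b c d] assms ab unfolding AB by auto
qed

lemma halves_neq_unit:
  assumes "sd_interval B"
  shows "left_half B \<noteq> (0, 1)" "right_half B \<noteq> (0, 1)"
  using mid_less[OF assms] sd_interval_bounds[of "fst B" "snd B"] assms
  by (auto simp: left_half_def right_half_def)

text \<open>Both interiors contain the common midpoint, so the intervals are nested; a proper s.d.
  subinterval stays in one half and misses the midpoint in its interior. This makes
  \<open>vertex_at\<close> well defined.\<close>

lemma sd_interval_mid_inject:
  assumes "sd_interval A" "sd_interval B" "mid A = mid B"
  shows "A = B"
proof (rule ccontr)
  assume neq: "A \<noteq> B"
  obtain a b c d where AB: "A = (a, b)" "B = (c, d)" by (cases A; cases B)
  note m = mid_less[OF assms(1)] mid_less[OF assms(2)]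
  have "a \<le> c \<and> d \<le> b \<or> c \<le> a \<and> b \<le> d"
    using m assms by (intro sd_interval_nested) (auto simp: AB)
  then show False
    using sd_interval_strict_sub[of a b c d] sd_interval_strict_sub[of c d a b] m assms neq
    by (auto simp: AB)
qed

text \<open>This is needed for carets inside a large s.d. interval on which a map is affine: their
  images are s.d. again because the subdivision is carried over piece by piece.\<close>

lemma sd_interval_affine_image:
  assumes "sd_interval (u, v)" "sd_interval (c, d)" "sd_interval (a, b)" "u \<le> a" "b \<le> v"
  shows "sd_interval (c + (d - c) / (v - u) * (a - u), c + (d - c) / (v - u) * (b - u))"
proof -
  obtain m k :: nat where mk: "k < 2 ^ m" "u = real k / 2 ^ m" "v = (real k + 1) / 2 ^ m"
    using assms(1) by (rule sd_intervalE)
  obtain p l :: nat where pl: "l < 2 ^ p" "c = real l / 2 ^ p" "d = (real l + 1) / 2 ^ p"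
    using assms(2) by (rule sd_intervalE)
  obtain q j :: nat where qj: "j < 2 ^ q" "a = real j / 2 ^ q" "b = (real j + 1) / 2 ^ q"
    using assms(3) by (rule sd_intervalE)
  have vu: "v - u = 1 / 2 ^ m" "d - c = 1 / 2 ^ p" "b - a = 1 / 2 ^ q"
    by (simp_all add: mk pl qj field_simps)
  have "1 / (2::real) ^ q \<le> 1 / 2 ^ m" using vu assms(4,5) by linarith
  then have "(2::real) ^ m \<le> 2 ^ q" by (simp add: field_simps)
  then have "m \<le> q" by simp
  then obtain e where e: "q = m + e" using le_Suc_ex by blast
  have "a < b" using sd_interval_bounds[OF assms(3)] by simp
  then have "u < b" "a < v" using assms(4,5) by linarith+
  then have je: "k * 2 ^ e \<le> j" "j + 1 \<le> (k + 1) * 2 ^ e"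
    using dyadic_subinterval[of k m j e] unfolding mk qj e by auto
  \<comment> \<open>\<open>(a, b)\<close> has number \<open>j - k * 2 ^ e\<close> among the
    \<open>2 ^ e\<close> equal pieces of \<open>(u, v)\<close>; its image has the same number in
    \<open>(c, d)\<close>. The truncated subtraction is exact by \<open>je\<close>.\<close>
  define i where "i = l * 2 ^ e + (j - k * 2 ^ e)"
  have "i < (l + 1) * 2 ^ e" using je by (simp add: i_def algebra_simps)
  also have "\<dots> \<le> 2 ^ p * 2 ^ e" by (rule mult_right_mono) (use pl in auto)
  finally have i: "i < 2 ^ (p + e)" by (simp add: power_add)
  have ir: "real i = real l * 2 ^ e + (real j - real k * 2 ^ e)"
    using je(1) by (simp add: i_def of_nat_diff)
  show ?thesis
  proof (rule sd_intervalI[OF i])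
    show "c + (d - c) / (v - u) * (a - u) = real i / 2 ^ (p + e)"
      unfolding vu by (simp add: ir mk pl qj e power_add field_simps)
    show "c + (d - c) / (v - u) * (b - u) = (real i + 1) / 2 ^ (p + e)"
      unfolding vu by (simp add: ir mk pl qj e power_add field_simps)
  qed
qed

section \<open>The tree of a partition\<close>

locale dyadic_partition =
  fixes I :: "real list"
  assumes sd_partition: "sd_partition I"
begin

abbreviation n where "n \<equiv> num_subints I"

lemma length_eq: "length I = Suc n" and n_pos: "0 < n"
  using sd_partition unfolding sd_partition_def num_subints_def by auto

lemma nth_0: "I ! 0 = 0" and nth_n: "I ! n = 1"
proof -
  have "I \<noteq> []" using length_eq by auto
  then show "I ! 0 = 0" "I ! n = 1"
    using sd_partition unfolding sd_partition_def num_subints_def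
    by (auto simp: hd_conv_nth last_conv_nth)
qed

lemma nth_less_iff: "i \<le> n \<Longrightarrow> j \<le> n \<Longrightarrow> I ! i < I ! j \<longleftrightarrow> i < j"
  and nth_le_iff: "i \<le> n \<Longrightarrow> j \<le> n \<Longrightarrow> I ! i \<le> I ! j \<longleftrightarrow> i \<le> j"
  and nth_eq_iff: "i \<le> n \<Longrightarrow> j \<le> n \<Longrightarrow> I ! i = I ! j \<longleftrightarrow> i = j"
proof -
  have *: "I ! i < I ! j" if "i < j" "j \<le> n" for i j
    using sd_partition that length_eq unfolding sd_partition_def
    by (auto simp: sorted_wrt_iff_nth_less)
  show "I ! i < I ! j \<longleftrightarrow> i < j" if "i \<le> n" "j \<le> n"
    using *[of i j] *[of j i] that by (cases i j rule: linorder_cases) auto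
  show "I ! i \<le> I ! j \<longleftrightarrow> i \<le> j" if "i \<le> n" "j \<le> n"
    using *[of i j] *[of j i] that by (cases i j rule: linorder_cases) auto
  show "I ! i = I ! j \<longleftrightarrow> i = j" if "i \<le> n" "j \<le> n"
    using *[of i j] *[of j i] that by (cases i j rule: linorder_cases) auto
qed

lemma subint_sd: "i < n \<Longrightarrow> sd_interval (I ! i, I ! Suc i)"
  using sd_partition unfolding sd_partition_def subint_def by auto

text \<open>A breakpoint lies in two subintervals. This version selects the one to its right and
  \<open>locate_left\<close> the one to its left, as suits the left and the right end of an
  interval.\<close>

lemma locate_right:
  assumes "0 \<le> x" "x < 1"
  obtains i where "i < n" "I ! i \<le> x" "x < I ! Suc i"
proof -
  define i where "i = (GREATEST i. i < n \<and> I ! i \<le> x)"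
  have *: "i < n \<and> I ! i \<le> x"
    unfolding i_def by (rule GreatestI_nat[of _ 0 n]) (use n_pos nth_0 assms in auto)
  have "x < I ! Suc i"
  proof (rule ccontr)
    assume c: "\<not> x < I ! Suc i"
    then have "Suc i \<noteq> n" using assms nth_n by auto
    then have "Suc i < n \<and> I ! Suc i \<le> x" using c * by auto
    then have "Suc i \<le> i" unfolding i_def by (intro Greatest_le_nat[of _ _ n]) auto
    then show False by simp
  qed
  with * that show ?thesis by blast
qed

lemma locate_left:
  assumes "0 < x" "x \<le> 1"
  obtains i where "i < n" "I ! i < x" "x \<le> I ! Suc i"
proof -
  define i where "i = (GREATEST i. i < n \<and> I ! i < x)"
  have *: "i < n \<and> I ! i < x"
    unfolding i_def by (rule GreatestI_nat[of _ 0 n]) (use n_pos nth_0 assms in auto)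
  have "x \<le> I ! Suc i"
  proof (rule ccontr)
    assume c: "\<not> x \<le> I ! Suc i"
    then have "Suc i \<noteq> n" using assms nth_n by auto
    then have "Suc i < n \<and> I ! Suc i < x" using c * by auto
    then have "Suc i \<le> i" unfolding i_def by (intro Greatest_le_nat[of _ _ n]) auto
    then show False by simp
  qed
  with * that show ?thesis by blast
qed

lemma edge_iff:
  "(u, v) \<in> tree_edges I \<longleftrightarrow> sd_interval (u, v) \<and> (\<exists>i j. i < j \<and> j \<le> n \<and> u = I ! i \<and> v = I ! j)"
  unfolding tree_edges_def using length_eq by (auto simp: less_Suc_eq_le)

lemma edgeI: "sd_interval (I ! i, I ! j) \<Longrightarrow> i < j \<Longrightarrow> j \<le> n \<Longrightarrow> (I ! i, I ! j) \<in> tree_edges I"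
  unfolding edge_iff by blast

lemma edge_sd: "B \<in> tree_edges I \<Longrightarrow> sd_interval B"
  unfolding tree_edges_def by auto

text \<open>The subinterval at either end of \<open>(u, v)\<close> is nested with it. If it lies
  inside, its end point is the end point of \<open>(u, v)\<close>; if it contains
  \<open>(u, v)\<close>, it also contains subinterval \<open>i\<close> and must be that one.\<close>

lemma edgeI_contains_subint:
  assumes "sd_interval (u, v)" "i < n" "u \<le> I ! i" "I ! Suc i \<le> v"
  shows "(u, v) \<in> tree_edges I"
proof -
  note uv = sd_interval_bounds[OF assms(1)]
  obtain k where k: "k < n" "I ! k \<le> u" "u < I ! Suc k"
    using locate_right[of u] uv by auto
  obtain l where l: "l < n" "I ! l < v" "v \<le> I ! Suc l"
    using locate_left[of v] uv by auto
  have u: "u = I ! k"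
  proof -
    have "u \<le> I ! k \<and> I ! Suc k \<le> v \<or> I ! k \<le> u \<and> v \<le> I ! Suc k"
      using assms(1) subint_sd[OF k(1)] uv k by (intro sd_interval_nested) auto
    then show ?thesis
    proof
      assume *: "I ! k \<le> u \<and> v \<le> I ! Suc k"
      then have "I ! k \<le> I ! i" "I ! Suc i \<le> I ! Suc k" using assms(3,4) by auto
      then have "k = i" using assms(2) k(1) by (simp add: nth_le_iff)
      then show ?thesis using * assms(3) by auto
    qed (use k in auto)
  qed
  have v: "v = I ! Suc l"
  proof -
    have "u \<le> I ! l \<and> I ! Suc l \<le> v \<or> I ! l \<le> u \<and> v \<le> I ! Suc l"
      using assms(1) subint_sd[OF l(1)] uv l by (intro sd_interval_nested) auto
    then show ?thesis
    proof
      assume *: "I ! l \<le> u \<and> v \<le> I ! Suc l"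
      then have "I ! l \<le> I ! i" "I ! Suc i \<le> I ! Suc l" using assms(3,4) by auto
      then have "l = i" using assms(2) l(1) by (simp add: nth_le_iff)
      then show ?thesis using * assms(4) by auto
    qed (use l in auto)
  qed
  have "I ! k < I ! Suc l" using u v uv by simp
  then have "k < Suc l" using k l by (simp add: nth_less_iff)
  with u v l assms(1) show ?thesis unfolding edge_iff by (intro conjI exI[of _ k] exI[of _ "Suc l"]) auto
qed

lemma finite_edges: "finite (tree_edges I)"
proof (rule finite_subset)
  show "tree_edges I \<subseteq> (\<lambda>(i, j). (I ! i, I ! j)) ` ({..<length I} \<times> {..<length I})"
    unfolding tree_edges_def by auto
qed simp

lemma vertex_edge: "B \<in> tree_vertices I \<Longrightarrow> B \<in> tree_edges I"
  and vertex_sd: "B \<in> tree_vertices I \<Longrightarrow> sd_interval B"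
  unfolding tree_vertices_def using edge_sd by auto

lemma finite_vertices: "finite (tree_vertices I)"
  using finite_edges unfolding tree_vertices_def by auto

lemma unit_edge: "(0, 1) \<in> tree_edges I"
  using sd_interval_unit n_pos unfolding edge_iff by (metis le_refl nth_0 nth_n)

lemma subint_edge: "i < n \<Longrightarrow> subint I i \<in> tree_edges I"
  unfolding subint_def edge_iff using subint_sd[of i] by (intro conjI exI[of _ i] exI[of _ "Suc i"]) auto

lemma edge_cases: "B \<in> tree_edges I \<Longrightarrow> B \<in> tree_vertices I \<or> (\<exists>i<n. B = subint I i)"
  unfolding tree_vertices_def tree_leaves_def by auto

lemma subint_not_vertex: "i < n \<Longrightarrow> subint I i \<notin> tree_vertices I"
  unfolding tree_vertices_def tree_leaves_def by auto

lemma vertexE: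
  assumes "B \<in> tree_vertices I"
  obtains i j where "Suc i < j" "j \<le> n" "B = (I ! i, I ! j)"
proof -
  obtain u v where B: "B = (u, v)" by (cases B)
  obtain i j where ij: "i < j" "j \<le> n" "u = I ! i" "v = I ! j"
    using vertex_edge[OF assms] unfolding B edge_iff by auto
  have "j \<noteq> Suc i"
    using assms subint_not_vertex[of i] ij unfolding B subint_def by auto
  with ij that[of i j] B show ?thesis by auto
qed

lemma vertexI:
  assumes "sd_interval (I ! i, I ! j)" "Suc i < j" "j \<le> n"
  shows "(I ! i, I ! j) \<in> tree_vertices I"
  unfolding tree_vertices_def tree_leaves_def
  using assms by (auto intro: edgeI simp: subint_def nth_eq_iff)

text \<open>The leftmost leaf below the vertex is a proper s.d. subinterval and hence lies in the
  left half. So the left half is an edge, and its right end, the midpoint, is a breakpoint.\<close>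

lemma vertex_mid:
  assumes "Suc i < j" "j \<le> n" "(I ! i, I ! j) \<in> tree_vertices I"
  obtains k where "i < k" "k < j" "mid (I ! i, I ! j) = I ! k"
proof -
  let ?B = "(I ! i, I ! j)"
  have sd: "sd_interval ?B" using vertex_sd assms(3) .
  have leaf: "sd_interval (I ! i, I ! Suc i)" using subint_sd[of i] assms by auto
  have "I ! Suc i < I ! j" using assms by (simp add: nth_less_iff)
  have "I ! Suc i \<le> mid ?B \<or> mid ?B \<le> I ! i"
    using assms sd leaf by (intro sd_interval_strict_sub) (auto simp: nth_le_iff nth_eq_iff)
  then have "I ! Suc i \<le> mid ?B" using mid_less[OF sd] by auto
  then have "(I ! i, mid ?B) \<in> tree_edges I"
    using sd_interval_halves[OF sd] assms
    by (intro edgeI_contains_subint[of _ _ i]) (auto simp: left_half_def)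
  then obtain k where k: "k \<le> n" "mid ?B = I ! k" unfolding edge_iff by auto
  then have "i < k" "k < j"
    using mid_less[OF sd] assms k by (auto simp: nth_less_iff)
  with k that show ?thesis by auto
qed

lemma halves_edge:
  assumes "B \<in> tree_vertices I"
  shows "left_half B \<in> tree_edges I" "right_half B \<in> tree_edges I"
proof -
  obtain i j where ij: "Suc i < j" "j \<le> n" "B = (I ! i, I ! j)" using assms by (rule vertexE)
  obtain k where k: "i < k" "k < j" "mid B = I ! k"
    using vertex_mid[OF ij(1,2)] assms unfolding ij(3) by metis
  show "left_half B \<in> tree_edges I" "right_half B \<in> tree_edges I"
    using sd_interval_halves[OF vertex_sd[OF assms]] ij k
    unfolding left_half_def right_half_def by (auto intro: edgeI)
qed

text \<open>The dyadic parent contains a subinterval of the partition, hence is an edge; being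
  strictly larger than another edge, it is no leaf.\<close>

lemma edge_parent:
  assumes "B \<in> tree_edges I" "B \<noteq> (0, 1)"
  obtains P where "P \<in> tree_vertices I" "B = left_half P \<or> B = right_half P"
proof -
  obtain P where P: "sd_interval P" "B = left_half P \<or> B = right_half P"
    using sd_interval_parent[OF edge_sd[OF assms(1)] assms(2)] by metis
  obtain i j where ij: "i < j" "j \<le> n" "B = (I ! i, I ! j)"
    using assms(1) by (cases B) (auto simp: edge_iff)
  note m = mid_less[OF P(1)]
  have sub: "fst P \<le> I ! i" "I ! j \<le> snd P" "B \<noteq> P"
    using P(2) m ij by (auto simp: left_half_def right_half_def prod_eq_iff)
  have "I ! Suc i \<le> I ! j" using ij by (simp add: nth_le_iff)
  then have "(fst P, snd P) \<in> tree_edges I"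
    using P(1) sub ij by (intro edgeI_contains_subint[of _ _ i]) auto
  moreover have "P \<noteq> subint I k" if "k < n" for k
  proof
    assume Pk: "P = subint I k"
    then have "I ! k \<le> I ! i" "I ! j \<le> I ! Suc k" using sub by (auto simp: subint_def)
    then have "k \<le> i" "j \<le> Suc k" using that ij by (simp_all add: nth_le_iff)
    then have "i = k" "j = Suc k" using ij by auto
    then have "B = P" using ij Pk by (simp add: subint_def)
    then show False using sub by simp
  qed
  ultimately have "P \<in> tree_vertices I" using edge_cases[of P] by auto
  with P(2) that show ?thesis by blast
qed

text \<open>A counterexample of maximal length would have a longer parent, which satisfies
  \<open>P\<close> and passes it on to its halves.\<close>

lemma edge_induct_down [consumes 1, case_names unit halves]:
  assumes "B \<in> tree_edges I" and "P (0, 1)"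
    and "\<And>B. B \<in> tree_vertices I \<Longrightarrow> P B \<Longrightarrow> P (left_half B) \<and> P (right_half B)"
  shows "P B"
proof (rule ccontr)
  assume neg: "\<not> P B"
  let ?A = "{B \<in> tree_edges I. \<not> P B}"
  have fin: "finite ((\<lambda>B. snd B - fst B) ` ?A)" using finite_edges by auto
  have "Max ((\<lambda>B. snd B - fst B) ` ?A) \<in> (\<lambda>B. snd B - fst B) ` ?A"
    by (rule Max_in[OF fin]) (use assms(1) neg in blast)
  then obtain C where C: "C \<in> ?A" and max: "snd C - fst C = Max ((\<lambda>B. snd B - fst B) ` ?A)"
    by auto
  have "C \<noteq> (0, 1)" using C assms(2) by auto
  then obtain D where D: "D \<in> tree_vertices I" "C = left_half D \<or> C = right_half D"
    using C edge_parent by blast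
  have "snd C - fst C < snd D - fst D"
    using D mid_less[OF vertex_sd[OF D(1)]] by (auto simp: left_half_def right_half_def)
  then have "D \<notin> ?A" using Max_ge[OF fin] unfolding max by (meson imageI not_le)
  then have "P D" using D vertex_edge by auto
  then show False using assms(3)[OF D(1)] D(2) C by auto
qed

text \<open>Dually, a counterexample of minimal length is no leaf, and its shorter halves satisfy
  \<open>P\<close>.\<close>

lemma edge_induct_up [consumes 1, case_names subint halves]:
  assumes "B \<in> tree_edges I" and "\<And>i. i < n \<Longrightarrow> P (subint I i)"
    and "\<And>B. B \<in> tree_vertices I \<Longrightarrow> P (left_half B) \<Longrightarrow> P (right_half B) \<Longrightarrow> P B"
  shows "P B"
proof (rule ccontr)
  assume neg: "\<not> P B"
  let ?A = "{B \<in> tree_edges I. \<not> P B}"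
  have fin: "finite ((\<lambda>B. snd B - fst B) ` ?A)" using finite_edges by auto
  have "Min ((\<lambda>B. snd B - fst B) ` ?A) \<in> (\<lambda>B. snd B - fst B) ` ?A"
    by (rule Min_in[OF fin]) (use assms(1) neg in blast)
  then obtain C where C: "C \<in> ?A" and min: "snd C - fst C = Min ((\<lambda>B. snd B - fst B) ` ?A)"
    by auto
  have CV: "C \<in> tree_vertices I" using C assms(2) edge_cases[of C] by auto
  note m = mid_less[OF vertex_sd[OF CV]]
  have *: "P D" if "D \<in> tree_edges I" "snd D - fst D < snd C - fst C" for D
    using that Min_le[OF fin] unfolding min by (metis (mono_tags, lifting) imageI mem_Collect_eq not_le)
  have "P (left_half C)" "P (right_half C)"
    using halves_edge[OF CV] m by (auto intro!: * simp: left_half_def right_half_def)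
  then show False using assms(3)[OF CV] C by auto
qed

section \<open>Vertices and interior breakpoints\<close>

lemma vertex_mid_nth:
  assumes "B \<in> tree_vertices I"
  obtains i where "0 < i" "i < n" "mid B = I ! i"
proof -
  obtain i j where ij: "Suc i < j" "j \<le> n" "B = (I ! i, I ! j)" using assms by (rule vertexE)
  obtain k where k: "i < k" "k < j" "mid B = I ! k"
    using vertex_mid[OF ij(1,2)] assms unfolding ij(3) by metis
  with ij that[of k] show ?thesis by auto
qed

text \<open>A breakpoint strictly inside an edge is its midpoint or strictly inside one of its
  halves. Leaves have no breakpoint inside, so the descent must end at a midpoint.\<close>

lemma vertex_ex:
  assumes "0 < i" "i < n"
  obtains B where "B \<in> tree_vertices I" "mid B = I ! i"
proof -
  have "fst B < I ! i \<Longrightarrow> I ! i < snd B \<Longrightarrow> \<exists>C \<in> tree_vertices I. mid C = I ! i"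
    if "B \<in> tree_edges I" for B
    using that
  proof (induction rule: edge_induct_up)
    case (subint k)
    then have "k < i" "i < Suc k" using assms by (simp_all add: subint_def nth_less_iff)
    then show ?case by simp
  next
    case (halves B)
    then show ?case
      by (cases "I ! i" "mid B" rule: linorder_cases) (auto simp: left_half_def right_half_def)
  qed
  from this[OF unit_edge] have "\<exists>C \<in> tree_vertices I. mid C = I ! i"
    using nth_less_iff[of 0 i] nth_less_iff[of i n] assms by (simp add: nth_0 nth_n)
  with that show ?thesis by blast
qed

lemma vertex_at:
  assumes "0 < i" "i < n"
  shows "vertex_at I (I ! i) \<in> tree_vertices I" "mid (vertex_at I (I ! i)) = I ! i"
proof -
  obtain B where "B \<in> tree_vertices I" "mid B = I ! i" using vertex_ex[OF assms] by metis
  then have "\<exists>!B. B \<in> tree_vertices I \<and> mid B = I ! i"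
    using sd_interval_mid_inject vertex_sd by metis
  from theI'[OF this] show "vertex_at I (I ! i) \<in> tree_vertices I" "mid (vertex_at I (I ! i)) = I ! i"
    unfolding vertex_at_def by auto
qed

lemma vertex_at_eqI: "B \<in> tree_vertices I \<Longrightarrow> mid B = I ! i \<Longrightarrow> 0 < i \<Longrightarrow> i < n \<Longrightarrow> vertex_at I (I ! i) = B"
  using vertex_at sd_interval_mid_inject vertex_sd by metis

lemma card_vertices: "card (tree_vertices I) = n - 1"
proof -
  have "bij_betw (\<lambda>i. vertex_at I (I ! i)) {0<..<n} (tree_vertices I)"
    unfolding bij_betw_def
  proof
    show "inj_on (\<lambda>i. vertex_at I (I ! i)) {0<..<n}"
    proof (rule inj_onI)
      fix i j assume ij: "i \<in> {0<..<n}" "j \<in> {0<..<n}" "vertex_at I (I ! i) = vertex_at I (I ! j)"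
      then have "I ! i = I ! j" by (metis greaterThanLessThan_iff vertex_at(2))
      then show "i = j" using ij by (simp add: nth_eq_iff)
    qed
    show "(\<lambda>i. vertex_at I (I ! i)) ` {0<..<n} = tree_vertices I"
    proof
      show "tree_vertices I \<subseteq> (\<lambda>i. vertex_at I (I ! i)) ` {0<..<n}"
      proof
        fix B assume B: "B \<in> tree_vertices I"
        then obtain i where "0 < i" "i < n" "mid B = I ! i" by (rule vertex_mid_nth)
        then show "B \<in> (\<lambda>i. vertex_at I (I ! i)) ` {0<..<n}"
          using vertex_at_eqI[OF B] by (intro image_eqI[of _ _ i]) auto
      qed
    qed (use vertex_at in auto)
  qed
  then show ?thesis using bij_betw_same_card[of _ "{0<..<n}"] by fastforce
qed

section \<open>Signs of edges and leaves\<close>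

lemma has_sign_edge: "has_sign I B s \<Longrightarrow> B \<in> tree_edges I"
  by (induction rule: has_sign.induct) (auto intro: unit_edge halves_edge)

text \<open>An edge is a half in at most one way and the root is not a half, so only one rule can
  derive its sign. This justifies the \<open>THE\<close> in \<open>edge_sign\<close>.\<close>

lemma has_sign_unique: "has_sign I B s \<Longrightarrow> has_sign I B t \<Longrightarrow> s = t"
proof (induction arbitrary: t rule: has_sign.induct)
  case root
  then show ?case
    by cases (use halves_neq_unit vertex_sd in metis)+
next
  case (left B s)
  note IH = left.IH and sd = vertex_sd[OF left.hyps(2)]
  from left.prems show ?case
  proof cases
    case root
    then show ?thesis using halves_neq_unit[OF sd] by auto
  next
    case (left C)
    then show ?thesis using IH left_half_inject by auto
  next
    case (right C)
    then show ?thesis using left_half_neq_right_half[OF sd vertex_sd] by metis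
  qed
next
  case (right B s)
  note IH = right.IH and sd = vertex_sd[OF right.hyps(2)]
  from right.prems show ?case
  proof cases
    case root
    then show ?thesis using halves_neq_unit[OF sd] by auto
  next
    case (left C)
    then show ?thesis using left_half_neq_right_half[OF vertex_sd sd] by metis
  next
    case (right C)
    then show ?thesis using IH right_half_inject by auto
  qed
qed

lemma has_sign_ex: "B \<in> tree_edges I \<Longrightarrow> \<exists>s. has_sign I B s"
  by (induction rule: edge_induct_down) (blast intro: has_sign.intros)+

lemma edge_sign_eqI: "has_sign I B s \<Longrightarrow> edge_sign I B = s"
  unfolding edge_sign_def using has_sign_unique by blast

lemma has_sign_edge_sign: "B \<in> tree_edges I \<Longrightarrow> has_sign I B (edge_sign I B)"
  using has_sign_ex edge_sign_eqI by blast

lemma edge_sign_unit: "edge_sign I (0, 1) = Plus"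
  by (intro edge_sign_eqI has_sign.root)

lemma edge_sign_left: "B \<in> tree_vertices I \<Longrightarrow> edge_sign I (left_half B) = edge_sign I B"
  and edge_sign_right: "B \<in> tree_vertices I \<Longrightarrow> edge_sign I (right_half B) = opp (edge_sign I B)"
  by (intro edge_sign_eqI has_sign.intros has_sign_edge_sign vertex_edge; assumption)+

text \<open>Left edges keep the sign, so the sign of an edge is the sign of the leaf with the same left
  end point.\<close>

lemma edge_sign_spine:
  assumes "B \<in> tree_edges I" "fst B = I ! i" "i < n"
  shows "edge_sign I B = edge_sign I (subint I i)"
  using assms
proof (induction rule: edge_induct_up)
  case (subint k)
  then have "k = i" by (simp add: subint_def nth_eq_iff)
  then show ?case by simp
next
  case (halves B)
  then show ?case using edge_sign_left[of B] by (simp add: left_half_def)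
qed

lemma length_leaf_signs: "length (leaf_signs I) = n"
  unfolding leaf_signs_def by simp

lemma nth_leaf_signs: "i < n \<Longrightarrow> leaf_signs I ! i = edge_sign I (subint I i)"
  unfolding leaf_signs_def by simp

lemma edge_sign_nth: "B \<in> tree_edges I \<Longrightarrow> fst B = I ! i \<Longrightarrow> i < n \<Longrightarrow> edge_sign I B = leaf_signs I ! i"
  using edge_sign_spine nth_leaf_signs by simp

lemma leaf_signs_0: "leaf_signs I ! 0 = Plus"
  using edge_sign_nth[OF unit_edge, of 0] n_pos nth_0 edge_sign_unit by simp

text \<open>Leaf \<open>i\<close> ends the left spine of the right half of \<open>B\<close>. Thus
  leaf signs determine the orientation of the vertical strands too, so equal leaf signs suffice to
  glue two trees.\<close>

lemma leaf_signs_vertex: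
  assumes "B \<in> tree_vertices I" "mid B = I ! i" "i < n"
  shows "leaf_signs I ! i = opp (edge_sign I B)"
  using edge_sign_nth[of "right_half B" i] edge_sign_right[OF assms(1)] halves_edge[OF assms(1)] assms
  by (simp add: right_half_def)

end

section \<open>The reduced pair\<close>

definition remove_nth :: "nat \<Rightarrow> 'a list \<Rightarrow> 'a list" where
  "remove_nth i xs = take i xs @ drop (Suc i) xs"

lemma length_remove_nth: "i < length xs \<Longrightarrow> length (remove_nth i xs) = length xs - 1"
  unfolding remove_nth_def by auto

text \<open>Index map from the list without entry \<open>i\<close> back to the full list.\<close>

definition skip :: "nat \<Rightarrow> nat \<Rightarrow> nat" where
  "skip i k = (if k < i then k else Suc k)"

lemma nth_remove_nth: "i < length xs \<Longrightarrow> remove_nth i xs ! k = xs ! skip i k"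
  unfolding remove_nth_def skip_def by (auto simp: nth_append min_def)

lemma skip_less_iff: "skip i k < skip i l \<longleftrightarrow> k < l"
  unfolding skip_def by auto

context dyadic_partition
begin

lemma caret_mid:
  assumes "Suc j < n" "sd_interval (I ! j, I ! Suc (Suc j))"
  shows "I ! Suc j = (I ! j + I ! Suc (Suc j)) / 2"
proof -
  have V: "(I ! j, I ! Suc (Suc j)) \<in> tree_vertices I" using assms by (intro vertexI) auto
  obtain k where "j < k" "k < Suc (Suc j)" "mid (I ! j, I ! Suc (Suc j)) = I ! k"
    using vertex_mid[OF _ _ V] assms by auto
  moreover from this have "k = Suc j" by simp
  ultimately show ?thesis by (simp add: mid_def)
qed

text \<open>Vertices of the coarser tree are vertices of the finer one, so signs carry over. The
  merged leaf starts where the left leaf of the caret did and inherits its sign; exactly the sign of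
  the right leaf disappears.\<close>

lemma remove_caret:
  assumes "Suc j < n" "sd_interval (I ! j, I ! Suc (Suc j))"
  shows "sd_partition (remove_nth (Suc j) I)"
    and "leaf_signs (remove_nth (Suc j) I) = remove_nth (Suc j) (leaf_signs I)"
proof -
  define I' where "I' = remove_nth (Suc j) I"
  have len: "length I' = n" unfolding I'_def using length_eq assms by (simp add: length_remove_nth)
  have nth: "I' ! k = I ! skip (Suc j) k" for k
    unfolding I'_def using length_eq assms by (simp add: nth_remove_nth)
  have skip_le: "skip (Suc j) k \<le> n" if "k < n" for k using that by (simp add: skip_def)
  have n': "num_subints I' = n - 1" unfolding num_subints_def len ..
  have "sd_interval (subint I' k)" if "k < n - 1" for k
    using that assms subint_sd[of k] subint_sd[of "Suc k"]
    by (cases "k = j") (auto simp: subint_def nth skip_def)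
  moreover have "sorted_wrt (<) I'"
    unfolding sorted_wrt_iff_nth_less by (auto simp: len nth nth_less_iff skip_le skip_less_iff)
  moreover have "I' \<noteq> []" using len n_pos by auto
  then have "hd I' = 0" "last I' = 1"
    using assms nth_0 nth_n by (auto simp: hd_conv_nth last_conv_nth nth len skip_def)
  ultimately have sd': "sd_partition I'"
    unfolding sd_partition_def n' using len assms by auto
  then show "sd_partition (remove_nth (Suc j) I)" unfolding I'_def .
  interpret P': dyadic_partition I' by unfold_locales (rule sd')
  have V: "B \<in> tree_vertices I" if B: "B \<in> tree_vertices I'" for B
  proof -
    obtain a b where ab: "Suc a < b" "b \<le> n - 1" "B = (I' ! a, I' ! b)"
      using P'.vertexE[OF B] unfolding n' by metis
    then have "Suc (skip (Suc j) a) < skip (Suc j) b" "skip (Suc j) b \<le> n"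
      using n_pos by (auto simp: skip_def)
    then show ?thesis
      using P'.vertex_sd[OF B] ab unfolding ab nth by (intro vertexI) auto
  qed
  have sign: "has_sign I B s" if "has_sign I' B s" for B s
    using that by induction (auto intro: has_sign.intros V)
  have "leaf_signs I' ! k = remove_nth (Suc j) (leaf_signs I) ! k" if k: "k < n - 1" for k
  proof -
    have "leaf_signs I' ! k = edge_sign I' (subint I' k)"
      using k n' by (simp add: P'.nth_leaf_signs)
    also have sg: "has_sign I (subint I' k) (edge_sign I' (subint I' k))"
      using k n' by (intro sign P'.has_sign_edge_sign P'.subint_edge) simp
    then have "edge_sign I' (subint I' k) = edge_sign I (subint I' k)"
      using edge_sign_eqI by simp
    also have "\<dots> = leaf_signs I ! skip (Suc j) k"
      using has_sign_edge[OF sg] k by (intro edge_sign_nth) (auto simp: subint_def nth skip_def)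
    finally show ?thesis using assms by (simp add: nth_remove_nth length_leaf_signs)
  qed
  then show "leaf_signs (remove_nth (Suc j) I) = remove_nth (Suc j) (leaf_signs I)"
    using assms n' unfolding I'_def[symmetric]
    by (intro nth_equalityI) (simp_all add: length_remove_nth length_leaf_signs P'.length_leaf_signs)
qed

text \<open>Descending to a half that is still a vertex, as long as there is one, ends at a vertex
  whose two halves are leaves.\<close>

lemma vertex_contains_caret:
  assumes "B \<in> tree_vertices I"
  shows "\<exists>j. Suc j < n \<and> sd_interval (I ! j, I ! Suc (Suc j)) \<and>
    fst B \<le> I ! j \<and> I ! Suc (Suc j) \<le> snd B"
proof -
  let ?P = "\<lambda>B. \<exists>j. Suc j < n \<and> sd_interval (I ! j, I ! Suc (Suc j)) \<and>
    fst B \<le> I ! j \<and> I ! Suc (Suc j) \<le> snd B"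
  have "B \<in> tree_vertices I \<longrightarrow> ?P B" if "B \<in> tree_edges I" for B
    using that
  proof (induction rule: edge_induct_up)
    case (subint i)
    then show ?case using subint_not_vertex by auto
  next
    case (halves B)
    note m = mid_less[OF vertex_sd[OF halves(1)]]
    have mono: "?P B" if "?P C" "fst B \<le> fst C" "snd C \<le> snd B" for C
      using that by (meson order_trans)
    consider "left_half B \<in> tree_vertices I" | "right_half B \<in> tree_vertices I"
      | a b where "a < n" "b < n" "left_half B = subint I a" "right_half B = subint I b"
      using halves_edge[OF halves(1)] edge_cases by metis
    then have "?P B"
    proof cases
      case 1
      then show ?thesis using halves(2) m by (intro mono[of "left_half B"]) (auto simp: left_half_def)
    next
      case 2
      then show ?thesis using halves(3) m by (intro mono[of "right_half B"]) (auto simp: right_half_def)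
    next
      \<comment> \<open>Both halves are leaves and share the midpoint as a breakpoint, so their
        indices are consecutive.\<close>
      case (3 a b)
      then have eq: "fst B = I ! a" "mid B = I ! Suc a" "mid B = I ! b" "snd B = I ! Suc b"
        by (auto simp: left_half_def right_half_def subint_def)
      then have "b = Suc a" using 3 by (simp add: nth_eq_iff)
      moreover have "sd_interval (fst B, snd B)" using vertex_sd[OF halves(1)] by simp
      ultimately show ?thesis using eq 3 by (intro exI[of _ a]) auto
    qed
    then show ?case ..
  qed
  then show ?thesis using assms vertex_edge by blast
qed

end

section \<open>Representing pairs and uniqueness of the reduced one\<close>

lemma representsD:
  assumes "represents I J g"
  shows "dyadic_partition I" "dyadic_partition J" "num_subints J = num_subints I"
    "i \<le> num_subints I \<Longrightarrow> J ! i = g (I ! i)"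
proof -
  show I: "dyadic_partition I" and "dyadic_partition J"
    and "num_subints J = num_subints I"
    using assms by (auto simp: represents_def dyadic_partition_def num_subints_def)
  interpret dyadic_partition I by (rule I)
  have lin: "g x = J ! k + (J ! Suc k - J ! k) / (I ! Suc k - I ! k) * (x - I ! k)"
    if "k < n" "I ! k \<le> x" "x \<le> I ! Suc k" for k x
    using assms that unfolding represents_def by auto
  show "J ! i = g (I ! i)" if i: "i \<le> n"
  proof (cases "i < n")
    case True
    then have "I ! i \<le> I ! Suc i" by (simp add: nth_le_iff)
    then show ?thesis using lin[of i "I ! i"] True by simp
  next
    case False
    \<comment> \<open>The last breakpoint starts no subinterval, so it is evaluated as the right end
      of the last one.\<close>
    then obtain k where k: "i = Suc k" "k < n" using i n_pos by (cases i) auto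
    then have "I ! k < I ! Suc k" by (simp add: nth_less_iff)
    then show ?thesis using lin[of k "I ! i"] k by simp
  qed
qed

text \<open>The condition mentions no partition, only \<open>g\<close>; this is what allows two
  reduced pairs of the same map to be compared.\<close>

definition linear_on_sd :: "(real \<Rightarrow> real) \<Rightarrow> interval \<Rightarrow> bool" where
  "linear_on_sd g B \<longleftrightarrow> sd_interval B \<and> (\<exists>c d. sd_interval (c, d) \<and>
     (\<forall>x \<in> {fst B..snd B}. g x = c + (d - c) / (snd B - fst B) * (x - fst B)))"

lemma represents_linear_on_sd:
  assumes "represents I J g" "i < num_subints I"
  shows "linear_on_sd g (subint I i)"
proof -
  have "sd_interval (J ! i, J ! Suc i)"
    using dyadic_partition.subint_sd[OF representsD(2)[OF assms(1)]] representsD(3)[OF assms(1)]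
      assms(2) by simp
  moreover have "sd_interval (subint I i)"
    using representsD(1)[OF assms(1)] dyadic_partition.subint_sd assms(2) by (simp add: subint_def)
  ultimately show ?thesis
    using assms unfolding linear_on_sd_def represents_def by (auto simp: subint_def)
qed

text \<open>The subintervals of the domain partition of a reduced pair are the maximal s.d. intervals
  that \<open>g\<close> maps affinely onto an s.d. interval; hence they are determined by \<open>g\<close>.\<close>

lemma reduced_subint_maximal:
  assumes rep: "represents I J g" and red: "reduced I J" and i: "i < num_subints I"
    and B: "linear_on_sd g B" "fst B \<le> I ! i" "I ! Suc i \<le> snd B"
  shows "B = subint I i"
proof (rule ccontr)
  assume neq: "B \<noteq> subint I i"
  interpret dyadic_partition I by (rule representsD(1)[OF rep])
  have sdB: "sd_interval (fst B, snd B)" using B(1) by (simp add: linear_on_sd_def)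
  then have "B \<in> tree_edges I" using edgeI_contains_subint[OF sdB i] B by simp
  moreover have "B \<noteq> subint I k" if "k < n" for k
  proof
    assume "B = subint I k"
    with B(2,3) have "I ! k \<le> I ! i" "I ! Suc i \<le> I ! Suc k" by (auto simp: subint_def)
    then have "k = i" using that i by (simp add: nth_le_iff)
    with \<open>B = subint I k\<close> neq show False by simp
  qed
  ultimately have "B \<in> tree_vertices I" using edge_cases by blast
  then obtain j where j: "Suc j < n" "sd_interval (I ! j, I ! Suc (Suc j))"
    "fst B \<le> I ! j" "I ! Suc (Suc j) \<le> snd B"
    using vertex_contains_caret by blast
  obtain c d where cd: "sd_interval (c, d)"
    and lin: "\<And>x. fst B \<le> x \<Longrightarrow> x \<le> snd B \<Longrightarrow> g x = c + (d - c) / (snd B - fst B) * (x - fst B)"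
    using B(1) unfolding linear_on_sd_def by auto
  have le: "I ! j \<le> I ! Suc (Suc j)" using j by (simp add: nth_le_iff)
  \<comment> \<open>The caret found inside \<open>B\<close> is mapped onto an s.d. interval, so it
    is a caret of both partitions, against reducedness.\<close>
  have "sd_interval (g (I ! j), g (I ! Suc (Suc j)))"
    using sd_interval_affine_image[OF sdB cd j(2-4)] lin[of "I ! j"] lin[of "I ! Suc (Suc j)"] j le
    by simp
  then have "sd_interval (J ! j, J ! Suc (Suc j))"
    using representsD(4)[OF rep] j by simp
  \<comment> \<open>\<open>reduced\<close> refers to a caret by its middle breakpoint, hence the
    index \<open>Suc j\<close>.\<close>
  then show False using red j unfolding reduced_def by (auto dest!: spec[of _ "Suc j"])
qed

text \<open>Subintervals of the two partitions that overlap are nested. The larger is one on which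
  \<open>g\<close> is affine onto an s.d. interval, so maximality of the smaller makes them
  equal.\<close>

lemma reduced_subints_subset:
  assumes "represents I J g" "reduced I J" "represents I' J' g" "reduced I' J'"
  shows "set I \<subseteq> set I'"
proof
  interpret P: dyadic_partition I by (rule representsD(1)[OF assms(1)])
  interpret P': dyadic_partition I' by (rule representsD(1)[OF assms(3)])
  fix x assume "x \<in> set I"
  then obtain i where i: "i \<le> P.n" "x = I ! i"
    using P.length_eq by (auto simp: in_set_conv_nth less_Suc_eq_le)
  show "x \<in> set I'"
  proof (cases "i < P.n")
    case True
    note bd = sd_interval_bounds[OF P.subint_sd[OF True]]
    obtain j where j: "j < P'.n" "I' ! j \<le> I ! i" "I ! i < I' ! Suc j"
      using P'.locate_right[of "I ! i"] bd by auto
    have "I' ! j \<le> I ! i \<and> I ! Suc i \<le> I' ! Suc j \<or> I ! i \<le> I' ! j \<and> I' ! Suc j \<le> I ! Suc i"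
      using P'.subint_sd[OF j(1)] P.subint_sd[OF True] j bd by (intro sd_interval_nested) auto
    then have "subint I' j = subint I i"
    proof
      assume "I' ! j \<le> I ! i \<and> I ! Suc i \<le> I' ! Suc j"
      then show ?thesis
        by (intro reduced_subint_maximal[OF assms(1,2) True] represents_linear_on_sd[OF assms(3) j(1)])
          (auto simp: subint_def)
    next
      assume "I ! i \<le> I' ! j \<and> I' ! Suc j \<le> I ! Suc i"
      then have "subint I i = subint I' j"
        by (intro reduced_subint_maximal[OF assms(3,4) j(1)] represents_linear_on_sd[OF assms(1) True])
          (auto simp: subint_def)
      then show ?thesis ..
    qed
    then have "x = I' ! j" by (simp add: i subint_def)
    then show ?thesis using j P'.length_eq by simp
  next
    case False
    then have "x = I' ! P'.n" using i P.nth_n P'.nth_n by simp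
    then show ?thesis using P'.length_eq by simp
  qed
qed

lemma reduced_pair_unique:
  assumes "represents I J g" "reduced I J" "represents I' J' g" "reduced I' J'"
  shows "I = I'" "J = J'"
proof -
  have "set I = set I'"
    using reduced_subints_subset[OF assms] reduced_subints_subset[OF assms(3,4,1,2)] by auto
  moreover have "sorted_wrt (<) I" "sorted_wrt (<) I'"
    using assms unfolding represents_def sd_partition_def by auto
  ultimately show I: "I = I'" by (metis strict_sorted_equal)
  have "length J = length J'" using I assms unfolding represents_def by simp
  moreover have "J ! i = J' ! i" if "i < length J" for i
  proof -
    have "i \<le> num_subints I" using that assms(1) unfolding represents_def num_subints_def by auto
    then show ?thesis using representsD(4)[OF assms(1)] representsD(4)[OF assms(3)] I by simp
  qed
  ultimately show "J = J'" by (rule nth_equalityI)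
qed

text \<open>Both carets are split at their midpoints, so the slopes on the two halves agree with
  each other and with the slope across the whole caret.\<close>

lemma represents_remove_caret:
  assumes rep: "represents I J g" and comp: "compatible I J" and j: "Suc j < num_subints I"
    and sd: "sd_interval (I ! j, I ! Suc (Suc j))" "sd_interval (J ! j, J ! Suc (Suc j))"
  shows "represents (remove_nth (Suc j) I) (remove_nth (Suc j) J) g"
    and "compatible (remove_nth (Suc j) I) (remove_nth (Suc j) J)"
proof -
  interpret P: dyadic_partition I by (rule representsD(1)[OF rep])
  interpret Q: dyadic_partition J by (rule representsD(2)[OF rep])
  have nn: "Q.n = P.n" by (rule representsD(3)[OF rep])
  have j': "Suc j < Q.n" using j nn by simp
  show "compatible (remove_nth (Suc j) I) (remove_nth (Suc j) J)"
    using comp P.remove_caret(2)[OF j sd(1)] Q.remove_caret(2)[OF j' sd(2)]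
    by (simp add: compatible_def)
  have lin: "g x = J ! k + (J ! Suc k - J ! k) / (I ! Suc k - I ! k) * (x - I ! k)"
    if "k < P.n" "I ! k \<le> x" "x \<le> I ! Suc k" for k x
    using rep that unfolding represents_def by auto
  have nth: "remove_nth (Suc j) I ! k = I ! skip (Suc j) k"
    "remove_nth (Suc j) J ! k = J ! skip (Suc j) k" for k
    using j nn P.length_eq Q.length_eq by (simp_all add: nth_remove_nth)
  have n': "num_subints (remove_nth (Suc j) I) = P.n - 1"
    using j unfolding num_subints_def by (simp add: length_remove_nth)
  have "g x = J ! skip (Suc j) k + (J ! skip (Suc j) (Suc k) - J ! skip (Suc j) k) /
      (I ! skip (Suc j) (Suc k) - I ! skip (Suc j) k) * (x - I ! skip (Suc j) k)"
    if k: "k < P.n - 1" and x: "I ! skip (Suc j) k \<le> x" "x \<le> I ! skip (Suc j) (Suc k)" for k x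
  proof (cases "k = j")
    case False
    then consider "k < j" | "j < k" by linarith
    then show ?thesis
    proof cases
      case 1
      then show ?thesis using lin[of k x] k x by (simp add: skip_def)
    next
      case 2
      then show ?thesis using lin[of "Suc k" x] k x by (simp add: skip_def)
    qed
  next
    case True
    let ?a = "I ! j" and ?b = "I ! Suc (Suc j)" and ?c = "J ! j" and ?d = "J ! Suc (Suc j)"
    have m: "I ! Suc j = (?a + ?b) / 2" "J ! Suc j = (?c + ?d) / 2"
      using P.caret_mid[OF j sd(1)] Q.caret_mid[OF j' sd(2)] .
    have ab: "?a < ?b" using sd_interval_bounds[OF sd(1)] by simp
    have "g x = ?c + (?d - ?c) / (?b - ?a) * (x - ?a)"
    proof (cases "x \<le> I ! Suc j")
      case True
      have "g x = ?c + (J ! Suc j - ?c) / (I ! Suc j - ?a) * (x - ?a)"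
        by (rule lin) (use j x True \<open>k = j\<close> in \<open>auto simp: skip_def\<close>)
      also have "(J ! Suc j - ?c) / (I ! Suc j - ?a) = (?d - ?c) / (?b - ?a)"
        unfolding m using ab by (simp add: field_simps)
      finally show ?thesis .
    next
      case False
      have "g x = J ! Suc j + (?d - J ! Suc j) / (?b - I ! Suc j) * (x - I ! Suc j)"
        by (rule lin) (use j x False \<open>k = j\<close> in \<open>auto simp: skip_def\<close>)
      also have "(?d - J ! Suc j) / (?b - I ! Suc j) = (?d - ?c) / (?b - ?a)"
        unfolding m using ab by (simp add: field_simps)
      also have "J ! Suc j + (?d - ?c) / (?b - ?a) * (x - I ! Suc j)
          = ?c + (?d - ?c) / (?b - ?a) * (x - ?a)"
        unfolding m using ab by (simp add: field_simps)
      finally show ?thesis .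
    qed
    then show ?thesis using True by (simp add: skip_def)
  qed
  moreover have "length (remove_nth (Suc j) I) = length (remove_nth (Suc j) J)"
    using j nn P.length_eq Q.length_eq by (simp add: length_remove_nth)
  ultimately show "represents (remove_nth (Suc j) I) (remove_nth (Suc j) J) g"
    unfolding represents_def n' nth
    using P.remove_caret(1)[OF j sd(1)] Q.remove_caret(1)[OF j' sd(2)] by simp
qed

text \<open>Common carets are removed until none is left; every removal shortens the
  partition.\<close>

lemma ex_compatible_reduced:
  assumes "represents I J g" "compatible I J"
  shows "\<exists>I' J'. represents I' J' g \<and> compatible I' J' \<and> reduced I' J'"
  using assms
proof (induction "length I" arbitrary: I J rule: less_induct)
  case less
  show ?case
  proof (cases "reduced I J")
    case True
    with less.prems show ?thesis by blast
  next
    case False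
    then obtain i where i: "1 \<le> i" "i \<le> num_subints I - 1"
      "sd_interval (I ! (i - 1), I ! (i + 1))" "sd_interval (J ! (i - 1), J ! (i + 1))"
      unfolding reduced_def by blast
    then obtain j where j: "i = Suc j" by (cases i) auto
    have jn: "Suc j < num_subints I" using i j by simp
    have "length (remove_nth (Suc j) I) < length I"
      using jn by (simp add: num_subints_def length_remove_nth)
    then show ?thesis
      using i j jn represents_remove_caret[OF less.prems jn] by (intro less.hyps) auto
  qed
qed

lemma reduced_pair_oriented:
  assumes "g \<in> oriented_thompson_F"
  obtains I J where "reduced_pair g = (I, J)" "represents I J g" "compatible I J"
proof -
  obtain I J where IJ: "represents I J g" "compatible I J" "reduced I J"
    using assms ex_compatible_reduced unfolding oriented_thompson_F_def by blast
  have "reduced_pair g = (I, J)"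
    unfolding reduced_pair_def
  proof (rule the_equality)
    show "case (I, J) of (I, J) \<Rightarrow> represents I J g \<and> reduced I J" using IJ by simp
  next
    fix p :: "real list \<times> real list"
    assume "case p of (I, J) \<Rightarrow> represents I J g \<and> reduced I J"
    then have "represents (fst p) (snd p) g" "reduced (fst p) (snd p)" by (auto simp: case_prod_beta)
    from reduced_pair_unique[OF this IJ(1,3)] show "p = (I, J)" by (simp add: prod_eq_iff)
  qed
  with IJ that show ?thesis by blast
qed

section \<open>Oriented arcs of the link\<close>

lemma opp_neq_iff: "opp s \<noteq> e \<longleftrightarrow> s = e" "opp s = e \<longleftrightarrow> s \<noteq> e"
  by (cases s; cases e; simp)+

lemma neq_opp: "s \<noteq> opp s"
  by (cases s) auto

datatype node = OverStrand interval | UnderStrand interval | Cap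

text \<open>The two strands passing through a crossing, the cap and the joins in the middle are the
  junctions at which the oriented arcs follow one another. At a junction of the upper tree,
  \<open>into I Plus\<close> is the arc that arrives and \<open>into I Minus\<close> the one that leaves; the lower tree has
  the reverse orientation, so there the roles of the signs are exchanged.\<close>

fun into :: "real list \<Rightarrow> esign \<Rightarrow> node \<Rightarrow> tree_arc" where
  "into I e (OverStrand B) = Edge (if edge_sign I B = e then left_half B else right_half B)"
| "into I e (UnderStrand B) = (if edge_sign I B = e then Vert B else Edge B)"
| "into I e Cap = (if e = Plus then Edge (0, 1) else FarLeft)"

definition nodes :: "real list \<Rightarrow> node set" where
  "nodes I = insert Cap (OverStrand ` tree_vertices I \<union> UnderStrand ` tree_vertices I)"

text \<open>Letting the arriving strands of a crossing leave along the other strand is the oriented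
  smoothing.\<close>

fun swap_node :: "node \<Rightarrow> node" where
  "swap_node (OverStrand B) = UnderStrand B"
| "swap_node (UnderStrand B) = OverStrand B"
| "swap_node Cap = Cap"

definition tree_arcs :: "real list \<Rightarrow> tree_arc set" where
  "tree_arcs I = insert FarLeft (Edge ` tree_edges I \<union> Vert ` tree_vertices I)"

text \<open>The strand on the far left plays the role of the vertical strand to the left of leaf \<open>0\<close>.\<close>

definition vert_end :: "real list \<Rightarrow> nat \<Rightarrow> tree_arc" where
  "vert_end I i = (if i = 0 then FarLeft else Vert (vertex_at I (I ! i)))"

text \<open>A component of the smoothed tree runs along a left spine; it is identified by the left end
  point of its edges.\<close>

fun pos :: "tree_arc \<Rightarrow> real" where
  "pos (Edge B) = fst B"
| "pos (Vert B) = mid B"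
| "pos FarLeft = 0"

text \<open>Whatever the sign, the smoothing pairs the parent with the left edge (same left end
  point) and the vertical strand with the right edge, which starts at the midpoint. At the cap both
  positions are 0.\<close>

lemma pos_swap_node: "pos (into I (opp e) (swap_node k)) = pos (into I e k)"
proof (cases k)
  case (OverStrand B)
  then show ?thesis
    by (cases "edge_sign I B"; cases e) (simp_all add: left_half_def right_half_def)
next
  case (UnderStrand B)
  then show ?thesis
    by (cases "edge_sign I B"; cases e) (simp_all add: left_half_def right_half_def)
next
  case Cap
  then show ?thesis by (cases e) simp_all
qed

context dyadic_partition
begin

lemma finite_tree_arcs: "finite (tree_arcs I)"
  unfolding tree_arcs_def using finite_edges finite_vertices by simp

lemma vert_end_vertex:
  assumes "B \<in> tree_vertices I"
  obtains i where "i < n" "Vert B = vert_end I i" "leaf_signs I ! i = opp (edge_sign I B)"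
proof -
  obtain i where i: "0 < i" "i < n" "mid B = I ! i" using assms by (rule vertex_mid_nth)
  then show ?thesis
    using that[of i] vertex_at_eqI[OF assms] leaf_signs_vertex[OF assms] by (simp add: vert_end_def)
qed

text \<open>The strand to the left of leaf \<open>i\<close> is always oriented against that leaf;
  for \<open>i = 0\<close>, \<open>FarLeft\<close> runs down and the leaf runs up.\<close>

lemma vert_end_cases:
  assumes "i < n"
  obtains "i = 0" "vert_end I i = FarLeft" "leaf_signs I ! i = Plus"
  | B where "B \<in> tree_vertices I" "mid B = I ! i" "vert_end I i = Vert B"
      "leaf_signs I ! i = opp (edge_sign I B)"
proof (cases "i = 0")
  case True
  then show ?thesis using that(1) leaf_signs_0 by (simp add: vert_end_def)
next
  case False
  then show ?thesis
    using that(2) vertex_at[of i] assms leaf_signs_vertex by (simp add: vert_end_def)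
qed

lemma pos_vert_end: "i < n \<Longrightarrow> pos (vert_end I i) = I ! i"
  by (erule vert_end_cases) (simp_all add: nth_0)

lemma vert_end_in: "i < n \<Longrightarrow> vert_end I i \<in> tree_arcs I"
  by (erule vert_end_cases) (auto simp: tree_arcs_def)

lemma into_in: "k \<in> nodes I \<Longrightarrow> into I e k \<in> tree_arcs I"
  by (auto simp: nodes_def tree_arcs_def halves_edge vertex_edge unit_edge)

text \<open>Edges picked at an over-strand have sign \<open>e\<close>, edges picked at an
  under-strand do not, and the root is not a half. So no arc arrives at two nodes.\<close>

lemma inj_into: "inj_on (into I e) (nodes I)"
proof (rule inj_onI)
  fix k l assume kl: "k \<in> nodes I" "l \<in> nodes I" "into I e k = into I e l"
  have sd: "B \<in> tree_vertices I \<Longrightarrow> sd_interval B" for B by (rule vertex_sd)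
  have neq: "left_half A \<noteq> right_half B" "right_half B \<noteq> left_half A"
    if "A \<in> tree_vertices I" "B \<in> tree_vertices I" for A B
    using left_half_neq_right_half[OF sd sd, of A B] that by metis+
  have un: "left_half A \<noteq> (0, 1)" "right_half A \<noteq> (0, 1)" "(0, 1) \<noteq> left_half A" "(0, 1) \<noteq> right_half A"
    if "A \<in> tree_vertices I" for A
    using halves_neq_unit[OF sd[OF that]] by metis+
  have sg: "edge_sign I (left_half A) = edge_sign I A" "edge_sign I (right_half A) = opp (edge_sign I A)"
    if "A \<in> tree_vertices I" for A
    using edge_sign_left[OF that] edge_sign_right[OF that] .
  have OU: "into I e (OverStrand A) \<noteq> into I e (UnderStrand B)"
    if "A \<in> tree_vertices I" "B \<in> tree_vertices I" for A B
    using sg[OF that(1)] by (auto simp: opp_neq_iff split: if_splits)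
  have OC: "into I e (OverStrand A) \<noteq> into I e Cap" and UC: "into I e (UnderStrand A) \<noteq> into I e Cap"
    if "A \<in> tree_vertices I" for A
    using un[OF that] edge_sign_unit by auto
  have OO: "A = B" if "A \<in> tree_vertices I" "B \<in> tree_vertices I"
    "into I e (OverStrand A) = into I e (OverStrand B)" for A B
    using neq[OF that(1,2)] neq[OF that(2,1)] that(3)
    by (auto simp: left_half_inject right_half_inject split: if_splits)
  have UU: "A = B" if "into I e (UnderStrand A) = into I e (UnderStrand B)" for A B
    using that by (auto split: if_splits)
  from kl show "k = l"
    unfolding nodes_def using OU OC UC OO UU
    by (cases k; cases l) (auto simp del: into.simps dest: sym)
qed

text \<open>For \<open>e = Plus\<close> in the upper tree: a leaf of sign \<open>Minus\<close> runs
  down and arrives at the middle line, not at a node. The next lemma does the same for vertical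
  strands, with the opposite sign condition.\<close>

lemma into_neq_leaf:
  assumes "k \<in> nodes I" "i < n" "leaf_signs I ! i \<noteq> e"
  shows "into I e k \<noteq> Edge (subint I i)"
proof
  assume eq: "into I e k = Edge (subint I i)"
  have "edge_sign I (subint I i) \<noteq> e" "subint I i \<notin> tree_vertices I"
    using assms nth_leaf_signs subint_not_vertex by auto
  moreover have "into I e k \<noteq> Edge C" if "edge_sign I C \<noteq> e" "C \<notin> tree_vertices I" for C
    using assms(1) that edge_sign_unit
    by (auto simp: nodes_def opp_neq_iff edge_sign_left edge_sign_right split: if_splits)
  ultimately show False using eq by blast
qed

lemma into_neq_vert_end:
  assumes "k \<in> nodes I" "i < n" "leaf_signs I ! i = e"
  shows "into I e k \<noteq> vert_end I i"
  using assms(2)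
proof (cases i rule: vert_end_cases)
  case 1
  then show ?thesis using assms by (auto simp: nodes_def split: if_splits)
next
  case (2 B)
  then show ?thesis
    using assms neq_opp[of "edge_sign I B"] by (auto simp: nodes_def split: if_splits)
qed

text \<open>Every arc has a head: inside the tree at a node, or at the middle line. With injectivity
  and the two preceding exclusions the head is unique.\<close>

lemma into_surj:
  assumes "x \<in> tree_arcs I"
  shows "x \<in> into I e ` nodes I \<or> (\<exists>i<n. leaf_signs I ! i \<noteq> e \<and> x = Edge (subint I i)) \<or>
    (\<exists>i<n. leaf_signs I ! i = e \<and> x = vert_end I i)"
proof (cases x)
  case FarLeft
  show ?thesis
  proof (cases e)
    case Plus
    then show ?thesis using FarLeft n_pos leaf_signs_0 by (auto simp: vert_end_def)
  next
    case Minus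
    then have "x = into I e Cap" using FarLeft by simp
    moreover have "Cap \<in> nodes I" by (simp add: nodes_def)
    ultimately show ?thesis by blast
  qed
next
  case (Vert B)
  then have B: "B \<in> tree_vertices I" using assms by (auto simp: tree_arcs_def)
  show ?thesis
  proof (cases "edge_sign I B = e")
    case True
    then have "x = into I e (UnderStrand B)" using Vert by simp
    moreover have "UnderStrand B \<in> nodes I" using B by (simp add: nodes_def)
    ultimately show ?thesis by blast
  next
    case False
    then show ?thesis using vert_end_vertex[OF B] Vert opp_neq_iff(2) by metis
  qed
next
  case (Edge B)
  then have B: "B \<in> tree_edges I" using assms by (auto simp: tree_arcs_def)
  show ?thesis
  proof (cases "edge_sign I B = e")
    case False
    show ?thesis
    proof (cases "B \<in> tree_vertices I")
      case True
      then have "x = into I e (UnderStrand B)" using Edge False by simp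
      moreover have "UnderStrand B \<in> nodes I" using True by (simp add: nodes_def)
      ultimately show ?thesis by blast
    next
      case nv: False
      then obtain i where "i < n" "B = subint I i" using edge_cases[OF B] by auto
      then show ?thesis using Edge False nth_leaf_signs by auto
    qed
  next
    case True
    show ?thesis
    proof (cases "B = (0, 1)")
      case root: True
      then have "x = into I e Cap" using Edge True edge_sign_unit by simp
      moreover have "Cap \<in> nodes I" by (simp add: nodes_def)
      ultimately show ?thesis by blast
    next
      case False
      then obtain P where P: "P \<in> tree_vertices I" "B = left_half P \<or> B = right_half P"
        using edge_parent[OF B] by metis
      have "x = into I e (OverStrand P)"
        using P(2)
      proof
        assume "B = left_half P"
        then show ?thesis using Edge True edge_sign_left[OF P(1)] by simp
      next
        assume "B = right_half P"
        then show ?thesis using Edge True edge_sign_right[OF P(1)] neq_opp[of "edge_sign I P"] by simp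
      qed
      moreover have "OverStrand P \<in> nodes I" using P(1) by (simp add: nodes_def)
      ultimately show ?thesis by blast
    qed
  qed
qed

lemma pos_nth:
  assumes "x \<in> tree_arcs I"
  obtains i where "i < n" "pos x = I ! i"
proof (cases x)
  case FarLeft
  then show ?thesis using that[of 0] n_pos nth_0 by simp
next
  case (Vert B)
  then have "B \<in> tree_vertices I" using assms by (auto simp: tree_arcs_def)
  then show ?thesis using vertex_mid_nth[of B] that Vert by auto
next
  case (Edge B)
  then have "B \<in> tree_edges I" using assms by (auto simp: tree_arcs_def)
  then obtain i j where "i < j" "j \<le> n" "fst B = I ! i" by (cases B) (auto simp: edge_iff)
  then show ?thesis using that[of i] Edge by simp
qed

text \<open>The left spine leads down from any edge to the leaf with the same left end point; other
  arcs first step to an edge at their own position. \<open>f\<close> and \<open>R\<close> are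
  abstract so that the lemma serves both trees of the link.\<close>

lemma connected_to_leaf:
  assumes R: "trans R" "refl R"
    and left: "\<And>B. B \<in> tree_vertices I \<Longrightarrow> (f (Edge B), f (Edge (left_half B))) \<in> R"
    and right: "\<And>B. B \<in> tree_vertices I \<Longrightarrow> (f (Vert B), f (Edge (right_half B))) \<in> R"
    and cap: "(f FarLeft, f (Edge (0, 1))) \<in> R"
    and x: "x \<in> tree_arcs I" "pos x = I ! i" "i < n"
  shows "(f x, f (Edge (subint I i))) \<in> R"
proof -
  have edge: "(f (Edge B), f (Edge (subint I i))) \<in> R" if "B \<in> tree_edges I" "fst B = I ! i" for B
    using that
  proof (induction rule: edge_induct_up)
    case (subint k)
    then have "k = i" using x(3) by (simp add: subint_def nth_eq_iff)
    then show ?case using R(2) by (simp add: refl_on_def)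
  next
    case (halves B)
    then have "(f (Edge (left_half B)), f (Edge (subint I i))) \<in> R" by (simp add: left_half_def)
    with left[OF halves(1)] show ?case by (rule transD[OF R(1)])
  qed
  show ?thesis
  proof (cases x)
    case (Edge B)
    then show ?thesis using edge x by (auto simp: tree_arcs_def)
  next
    case (Vert B)
    then have B: "B \<in> tree_vertices I" using x by (auto simp: tree_arcs_def)
    have "(f (Edge (right_half B)), f (Edge (subint I i))) \<in> R"
      using halves_edge[OF B] x Vert by (intro edge) (auto simp: right_half_def)
    with right[OF B] show ?thesis unfolding Vert by (rule transD[OF R(1)])
  next
    case FarLeft
    have "(f (Edge (0, 1)), f (Edge (subint I i))) \<in> R"
      using unit_edge x FarLeft by (intro edge) auto
    with cap show ?thesis unfolding FarLeft by (rule transD[OF R(1)])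
  qed
qed

text \<open>Inverse of indexing on the left end points of the subintervals.\<close>

definition index :: "real \<Rightarrow> nat" where
  "index u = (THE i. i < n \<and> I ! i = u)"

lemma index_nth: "i < n \<Longrightarrow> index (I ! i) = i"
  unfolding index_def by (rule the_equality) (auto simp: nth_eq_iff)

end

section \<open>Junctions and arcs of the whole link\<close>

datatype junction = TopNode node | BottomNode node | LeafEnd nat | VertEnd nat

text \<open>As for \<open>into\<close>, \<open>Plus\<close> selects the arriving and
  \<open>Minus\<close> the leaving arc. A leaf of sign \<open>Plus\<close> crosses the middle line
  upward, from the lower into the upper tree, and the strand on its left crosses downward; a leaf of
  sign \<open>Minus\<close> reverses both.\<close>

fun incoming :: "real list \<Rightarrow> real list \<Rightarrow> esign \<Rightarrow> junction \<Rightarrow> tree_arc + tree_arc" where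
  "incoming I J e (TopNode k) = Inl (into I e k)"
| "incoming I J e (BottomNode k) = Inr (into J (opp e) k)"
| "incoming I J e (LeafEnd i) =
     (if leaf_signs I ! i = e then Inr (Edge (subint J i)) else Inl (Edge (subint I i)))"
| "incoming I J e (VertEnd i) =
     (if leaf_signs I ! i = e then Inl (vert_end I i) else Inr (vert_end J i))"

definition junctions :: "real list \<Rightarrow> real list \<Rightarrow> junction set" where
  "junctions I J = TopNode ` nodes I \<union> BottomNode ` nodes J \<union>
     LeafEnd ` {..<num_subints I} \<union> VertEnd ` {..<num_subints I}"

fun swap_junction :: "junction \<Rightarrow> junction" where
  "swap_junction (TopNode k) = TopNode (swap_node k)"
| "swap_junction (BottomNode k) = BottomNode (swap_node k)"
| "swap_junction (LeafEnd i) = LeafEnd i"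
| "swap_junction (VertEnd i) = VertEnd i"

definition link_arcs :: "real list \<Rightarrow> real list \<Rightarrow> (tree_arc + tree_arc) set" where
  "link_arcs I J = Inl ` tree_arcs I \<union> Inr ` tree_arcs J"

lemma zip_concat_pairs:
  "zip (concat (map (\<lambda>i. [a i, b i]) xs)) (concat (map (\<lambda>i. [c i, d i]) xs)) =
    concat (map (\<lambda>i. [(a i, c i), (b i, d i)]) xs)"
  by (induction xs) auto

text \<open>The added strand gives leaf 0 a partner on its left, so the end points become a uniform
  list of pairs.\<close>

lemma bottom_ends_capped:
  assumes "0 < num_subints I"
  shows "bottom_ends (capped_tree_tangle I) =
    concat (map (\<lambda>i. [Lower (vert_end I i), Lower (Edge (subint I i))]) [0..<num_subints I])"
proof -
  have eq: "map (\<lambda>i. [Lower (Vert (vertex_at I (I ! i))), Lower (Edge (subint I i))])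
      [Suc 0..<num_subints I] =
    map (\<lambda>i. [Lower (vert_end I i), Lower (Edge (subint I i))]) [Suc 0..<num_subints I]"
    by (auto simp: vert_end_def)
  have "vert_end I 0 = FarLeft" by (simp add: vert_end_def)
  then show ?thesis
    using assms by (simp add: capped_tree_tangle_def tree_tangle_def upt_conv_Cons Let_def eq)
qed

lemma map_concat_pairs:
  "map h (concat (map (\<lambda>i. [a i, b i]) xs)) = concat (map (\<lambda>i. [h (a i), h (b i)]) xs)"
  by (induction xs) auto

lemma set_concat_pairs: "set (concat (map (\<lambda>i. [a i, b i]) xs)) = a ` set xs \<union> b ` set xs"
  by (induction xs) auto

lemma consecutive_altdef:
  "consecutive T = (\<lambda>(p, q, r, s). (arc_of p, arc_of r)) ` crossings T \<union>
     (\<lambda>(p, q, r, s). (arc_of q, arc_of s)) ` crossings T \<union> map_prod arc_of arc_of ` joins T"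
  unfolding consecutive_def by force

text \<open>Reflection reverses the cyclic order at a crossing, which is why right edges precede
  left edges in the lower tree.\<close>

lemma consecutive_pair_link:
  assumes "0 < num_subints I" "num_subints J = num_subints I"
  shows "consecutive (pair_link I J) =
    {(Inl (Edge B), Inl (Vert B)) |B. B \<in> tree_vertices I} \<union>
    {(Inl (Edge (left_half B)), Inl (Edge (right_half B))) |B. B \<in> tree_vertices I} \<union>
    {(Inl FarLeft, Inl (Edge (0, 1)))} \<union>
    {(Inr (Edge B), Inr (Vert B)) |B. B \<in> tree_vertices J} \<union>
    {(Inr (Edge (right_half B)), Inr (Edge (left_half B))) |B. B \<in> tree_vertices J} \<union>
    {(Inr FarLeft, Inr (Edge (0, 1)))} \<union>
    {(Inl (vert_end I i), Inr (vert_end J i)) |i. i < num_subints I} \<union>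
    {(Inl (Edge (subint I i)), Inr (Edge (subint J i))) |i. i < num_subints I}"
proof -
  let ?S = "tangle_relabel Inl (capped_tree_tangle I)"
  let ?T = "tangle_relabel Inr (tangle_reverse (tangle_reflect (capped_tree_tangle J)))"
  have S: "crossings ?S = (\<lambda>B. (Lower (Inl (Edge B)), Upper (Inl (Edge (left_half B))),
      Upper (Inl (Vert B)), Upper (Inl (Edge (right_half B))))) ` tree_vertices I"
    "joins ?S = {(Upper (Inl FarLeft), Upper (Inl (Edge (0, 1))))}"
    by (simp_all add: tangle_relabel_def capped_tree_tangle_def tree_tangle_def Let_def image_image)
  have T: "crossings ?T = (\<lambda>B. (Upper (Inr (Edge B)), Lower (Inr (Edge (right_half B))),
      Lower (Inr (Vert B)), Lower (Inr (Edge (left_half B))))) ` tree_vertices J"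
    "joins ?T = {(Lower (Inr FarLeft), Lower (Inr (Edge (0, 1))))}"
    by (simp_all add: tangle_relabel_def tangle_reverse_def tangle_reflect_def
        capped_tree_tangle_def tree_tangle_def Let_def image_image)
  have Sb: "bottom_ends ?S = concat (map (\<lambda>i. [Lower (Inl (vert_end I i)),
      Lower (Inl (Edge (subint I i)))]) [0..<num_subints I])"
    using bottom_ends_capped[OF assms(1)]
    by (simp add: tangle_relabel_def Let_def map_concat_pairs)
  have Tt: "top_ends ?T = concat (map (\<lambda>i. [Upper (Inr (vert_end J i)),
      Upper (Inr (Edge (subint J i)))]) [0..<num_subints I])"
    using bottom_ends_capped[of J] assms
    by (simp add: tangle_relabel_def tangle_reverse_def tangle_reflect_def Let_def map_concat_pairs)
  have crossings: "crossings (pair_link I J) = crossings ?S \<union> crossings ?T"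
    and joins: "joins (pair_link I J) = joins ?S \<union> joins ?T \<union> set (zip (bottom_ends ?S) (top_ends ?T))"
    unfolding pair_link_def tangle_stack_def by (simp_all add: Let_def)
  show ?thesis
    unfolding consecutive_altdef crossings joins S T Sb Tt zip_concat_pairs set_concat_pairs
      image_Un image_image Setcompr_eq_image
    by (auto simp: Setcompr_eq_image)
qed

lemma arcs_pair_link: "arcs (pair_link I J) = link_arcs I J"
  by (simp add: pair_link_def tangle_stack_def tangle_relabel_def tangle_reverse_def
      tangle_reflect_def capped_tree_tangle_def tree_tangle_def Let_def link_arcs_def tree_arcs_def)

section \<open>Flow and smoothing of the link of a compatible pair\<close>

locale compatible_pair =
  P: dyadic_partition I + Q: dyadic_partition J for I J +
  assumes same_n: "num_subints J = num_subints I" and signs: "leaf_signs J = leaf_signs I"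
begin

text \<open>Every arc has one head (\<open>e = Plus\<close>) and one tail
  (\<open>e = Minus\<close>). Equal leaf signs enter at the middle joins: of the two arcs meeting
  there exactly one arrives.\<close>

lemma bij_incoming: "bij_betw (incoming I J e) (junctions I J) (link_arcs I J)"
  unfolding bij_betw_def
proof
  have P: "into I e k \<noteq> Edge (subint I i)" if "k \<in> nodes I" "i < P.n" "leaf_signs I ! i \<noteq> e" for k i
    using P.into_neq_leaf that .
  have Q: "into J (opp e) k \<noteq> Edge (subint J i)" if "k \<in> nodes J" "i < P.n" "leaf_signs I ! i = e" for k i
    using Q.into_neq_leaf[of k i "opp e"] that signs same_n opp_neq_iff by metis
  have P': "into I e k \<noteq> vert_end I i" if "k \<in> nodes I" "i < P.n" "leaf_signs I ! i = e" for k i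
    using P.into_neq_vert_end that .
  have Q': "into J (opp e) k \<noteq> vert_end J i" if "k \<in> nodes J" "i < P.n" "leaf_signs I ! i \<noteq> e" for k i
    using Q.into_neq_vert_end[of k i "opp e"] that signs same_n opp_neq_iff by metis
  have vv: "vert_end I i = vert_end I j \<longleftrightarrow> i = j" "vert_end J i = vert_end J j \<longleftrightarrow> i = j"
    "subint I i = subint I j \<longleftrightarrow> i = j" "subint J i = subint J j \<longleftrightarrow> i = j"
    if "i < P.n" "j < P.n" for i j
    using that P.pos_vert_end[of i] P.pos_vert_end[of j] Q.pos_vert_end[of i] Q.pos_vert_end[of j]
      same_n P.nth_eq_iff[of i j] Q.nth_eq_iff[of i j]
    by (auto simp: subint_def)
  have ve: "vert_end I i \<noteq> Edge B" "vert_end J i \<noteq> Edge B" "Edge B \<noteq> vert_end I i"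
    "Edge B \<noteq> vert_end J i" for i B by (auto simp: vert_end_def)
  show "inj_on (incoming I J e) (junctions I J)"
  proof (rule inj_onI)
    fix k l assume kl: "k \<in> junctions I J" "l \<in> junctions I J" "incoming I J e k = incoming I J e l"
    show "k = l"
      using kl P Q P' Q' vv ve inj_onD[OF P.inj_into, of e] inj_onD[OF Q.inj_into, of "opp e"]
      unfolding junctions_def
      by (cases k; cases l) (auto split: if_splits dest: sym)
  qed
  show "incoming I J e ` junctions I J = link_arcs I J"
  proof
    show "incoming I J e ` junctions I J \<subseteq> link_arcs I J"
    proof -
      have "Edge (subint I i) \<in> tree_arcs I" "Edge (subint J i) \<in> tree_arcs J" if "i < P.n" for i
        using that P.subint_edge Q.subint_edge same_n by (auto simp: tree_arcs_def)
      then show ?thesis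
        using P.vert_end_in Q.vert_end_in P.into_in Q.into_in same_n
        by (auto simp: junctions_def link_arcs_def)
    qed
    show "link_arcs I J \<subseteq> incoming I J e ` junctions I J"
    proof
      fix x assume "x \<in> link_arcs I J"
      then consider y where "x = Inl y" "y \<in> tree_arcs I" | y where "x = Inr y" "y \<in> tree_arcs J"
        by (auto simp: link_arcs_def)
      then show "x \<in> incoming I J e ` junctions I J"
      proof cases
        case 1
        from P.into_surj[OF 1(2), of e] show ?thesis
        proof (elim disjE exE conjE imageE)
          fix k assume "y = into I e k" "k \<in> nodes I"
          then show ?thesis using 1 by (intro image_eqI[of _ _ "TopNode k"]) (auto simp: junctions_def)
        next
          fix i assume "i < P.n" "leaf_signs I ! i \<noteq> e" "y = Edge (subint I i)"
          then show ?thesis using 1 by (intro image_eqI[of _ _ "LeafEnd i"]) (auto simp: junctions_def)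
        next
          fix i assume "i < P.n" "leaf_signs I ! i = e" "y = vert_end I i"
          then show ?thesis using 1 by (intro image_eqI[of _ _ "VertEnd i"]) (auto simp: junctions_def)
        qed
      next
        case 2
        from Q.into_surj[OF 2(2), of "opp e"] show ?thesis
          unfolding same_n signs
        proof (elim disjE exE conjE imageE)
          fix k assume "y = into J (opp e) k" "k \<in> nodes J"
          then show ?thesis using 2 by (intro image_eqI[of _ _ "BottomNode k"]) (auto simp: junctions_def)
        next
          fix i assume "i < P.n" "leaf_signs I ! i \<noteq> opp e" "y = Edge (subint J i)"
          moreover from this have "leaf_signs I ! i = e" using opp_neq_iff(1) by metis
          ultimately show ?thesis
            using 2 by (intro image_eqI[of _ _ "LeafEnd i"]) (auto simp: junctions_def)
        next
          fix i assume "i < P.n" "leaf_signs I ! i = opp e" "y = vert_end J i"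
          moreover from this have "leaf_signs I ! i \<noteq> e" using neq_opp by metis
          ultimately show ?thesis
            using 2 by (intro image_eqI[of _ _ "VertEnd i"]) (auto simp: junctions_def)
        qed
      qed
    qed
  qed
qed

lemma finite_link_arcs: "finite (link_arcs I J)"
  unfolding link_arcs_def using P.finite_tree_arcs Q.finite_tree_arcs by simp

text \<open>An arc arriving at \<open>k\<close> continues as the arc leaving \<open>s k\<close>:
  \<open>id\<close> follows the link, \<open>swap_junction\<close> the smoothed diagram.\<close>

definition flow :: "(junction \<Rightarrow> junction) \<Rightarrow> ((tree_arc + tree_arc) \<times> (tree_arc + tree_arc)) set" where
  "flow s = {(incoming I J Plus k, incoming I J Minus (s k)) |k. k \<in> junctions I J}"

text \<open>Orienting each consecutive pair only chooses its direction, so the undirected components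
  of the link are the cycles of the flow.\<close>

lemma flow_id: "flow id \<union> (flow id)\<inverse> = consecutive (pair_link I J) \<union> (consecutive (pair_link I J))\<inverse>"
proof -
  let ?c = "consecutive (pair_link I J)"
  note c = consecutive_pair_link[OF P.n_pos same_n]
  have cI: "(Inl (Edge B), Inl (Vert B)) \<in> ?c"
    "(Inl (Edge (left_half B)), Inl (Edge (right_half B))) \<in> ?c" if "B \<in> tree_vertices I" for B
    unfolding c using that by blast+
  have cJ: "(Inr (Edge B), Inr (Vert B)) \<in> ?c"
    "(Inr (Edge (right_half B)), Inr (Edge (left_half B))) \<in> ?c" if "B \<in> tree_vertices J" for B
    unfolding c using that by blast+
  have ci: "(Inl (vert_end I i), Inr (vert_end J i)) \<in> ?c"
    "(Inl (Edge (subint I i)), Inr (Edge (subint J i))) \<in> ?c" if "i < P.n" for i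
    unfolding c using that by blast+
  have cc: "(Inl FarLeft, Inl (Edge (0, 1))) \<in> ?c" "(Inr FarLeft, Inr (Edge (0, 1))) \<in> ?c"
    unfolding c by blast+
  have "flow id \<subseteq> ?c \<union> ?c\<inverse>"
  proof
    fix x assume "x \<in> flow id"
    then obtain k where k: "k \<in> junctions I J" "x = (incoming I J Plus k, incoming I J Minus k)"
      by (auto simp: flow_def)
    show "x \<in> ?c \<union> ?c\<inverse>"
    proof (cases k)
      case (TopNode l)
      then have l: "l \<in> nodes I" using k(1) by (auto simp: junctions_def)
      show ?thesis
      proof (cases l)
        case (OverStrand B)
        then have "B \<in> tree_vertices I" using l by (auto simp: nodes_def)
        from cI[OF this] show ?thesis
          unfolding k(2) TopNode OverStrand by (cases "edge_sign I B") simp_all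
      next
        case (UnderStrand B)
        then have "B \<in> tree_vertices I" using l by (auto simp: nodes_def)
        from cI[OF this] show ?thesis
          unfolding k(2) TopNode UnderStrand by (cases "edge_sign I B") simp_all
      next
        case Cap
        then show ?thesis using cc unfolding k(2) TopNode by simp
      qed
    next
      case (BottomNode l)
      then have l: "l \<in> nodes J" using k(1) by (auto simp: junctions_def)
      show ?thesis
      proof (cases l)
        case (OverStrand B)
        then have "B \<in> tree_vertices J" using l by (auto simp: nodes_def)
        from cJ[OF this] show ?thesis
          unfolding k(2) BottomNode OverStrand by (cases "edge_sign J B") simp_all
      next
        case (UnderStrand B)
        then have "B \<in> tree_vertices J" using l by (auto simp: nodes_def)
        from cJ[OF this] show ?thesis
          unfolding k(2) BottomNode UnderStrand by (cases "edge_sign J B") simp_all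
      next
        case Cap
        then show ?thesis using cc unfolding k(2) BottomNode by simp
      qed
    next
      case (LeafEnd i)
      then have "i < P.n" using k(1) by (auto simp: junctions_def)
      from ci[OF this] show ?thesis unfolding k(2) LeafEnd by (cases "leaf_signs I ! i") simp_all
    next
      case (VertEnd i)
      then have "i < P.n" using k(1) by (auto simp: junctions_def)
      from ci[OF this] show ?thesis unfolding k(2) VertEnd by (cases "leaf_signs I ! i") simp_all
    qed
  qed
  moreover have "?c \<subseteq> flow id \<union> (flow id)\<inverse>"
  proof -
    have flowI: "(incoming I J Plus k, incoming I J Minus k) \<in> flow id \<union> (flow id)\<inverse>"
      "(incoming I J Minus k, incoming I J Plus k) \<in> flow id \<union> (flow id)\<inverse>"
      if "k \<in> junctions I J" for k
      using that by (auto simp: flow_def)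
    have "(Inl (Edge B), Inl (Vert B)) \<in> flow id \<union> (flow id)\<inverse>"
      "(Inl (Edge (left_half B)), Inl (Edge (right_half B))) \<in> flow id \<union> (flow id)\<inverse>"
      if "B \<in> tree_vertices I" for B
      using that flowI[of "TopNode (UnderStrand B)"] flowI[of "TopNode (OverStrand B)"]
      by (cases "edge_sign I B"; simp add: junctions_def nodes_def)+
    moreover have "(Inr (Edge B), Inr (Vert B)) \<in> flow id \<union> (flow id)\<inverse>"
      "(Inr (Edge (right_half B)), Inr (Edge (left_half B))) \<in> flow id \<union> (flow id)\<inverse>"
      if "B \<in> tree_vertices J" for B
      using that flowI[of "BottomNode (UnderStrand B)"] flowI[of "BottomNode (OverStrand B)"]
      by (cases "edge_sign J B"; simp add: junctions_def nodes_def)+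
    moreover have "(Inl (vert_end I i), Inr (vert_end J i)) \<in> flow id \<union> (flow id)\<inverse>"
      "(Inl (Edge (subint I i)), Inr (Edge (subint J i))) \<in> flow id \<union> (flow id)\<inverse>"
      if "i < P.n" for i
      using that flowI[of "VertEnd i"] flowI[of "LeafEnd i"]
      by (cases "leaf_signs I ! i"; simp add: junctions_def)+
    moreover have "(Inl FarLeft, Inl (Edge (0, 1))) \<in> flow id \<union> (flow id)\<inverse>"
      "(Inr FarLeft, Inr (Edge (0, 1))) \<in> flow id \<union> (flow id)\<inverse>"
      using flowI[of "TopNode Cap"] flowI[of "BottomNode Cap"]
      by (simp_all add: junctions_def nodes_def)
    ultimately show ?thesis unfolding c by blast
  qed
  ultimately show ?thesis by blast
qed

lemma flow_swapI:
  assumes "k \<in> junctions I J" "a = incoming I J Plus k" "b = incoming I J Minus (swap_junction k)"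
  shows "(a, b) \<in> (flow swap_junction \<union> (flow swap_junction)\<inverse>)\<^sup>*"
    "(b, a) \<in> (flow swap_junction \<union> (flow swap_junction)\<inverse>)\<^sup>*"
proof -
  have "(a, b) \<in> flow swap_junction" unfolding flow_def using assms by blast
  then show "(a, b) \<in> (flow swap_junction \<union> (flow swap_junction)\<inverse>)\<^sup>*"
    "(b, a) \<in> (flow swap_junction \<union> (flow swap_junction)\<inverse>)\<^sup>*"
    by (simp_all add: r_into_rtrancl)
qed

text \<open>Positions in the two trees are breakpoints of different partitions; their indices are
  comparable.\<close>

definition label :: "tree_arc + tree_arc \<Rightarrow> nat" where
  "label x = (case x of Inl y \<Rightarrow> P.index (pos y) | Inr y \<Rightarrow> Q.index (pos y))"

text \<open>The label is a complete invariant: \<open>pos\<close> is constant along smoothed strands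
  of either tree, the joins preserve the index, and every arc is connected to the upper leaf that
  carries its label.\<close>

lemma component_count_smoothing: "component_count (link_arcs I J) (flow swap_junction) = P.n"
proof -
  let ?R = "(flow swap_junction \<union> (flow swap_junction)\<inverse>)\<^sup>*"
  have "component_count (link_arcs I J) (flow swap_junction) = card (label ` link_arcs I J)"
  proof (rule component_count_eq_card_image)
    fix a b assume "(a, b) \<in> flow swap_junction"
    then obtain k where k: "k \<in> junctions I J" "a = incoming I J Plus k"
      "b = incoming I J Minus (swap_junction k)" by (auto simp: flow_def)
    show "label a = label b"
    proof (cases k)
      case (TopNode l)
      then show ?thesis using k pos_swap_node[of I Plus l] by (simp add: label_def)
    next
      case (BottomNode l)
      \<comment> \<open>\<open>Minus\<close> occurs because the lower tree uses
        \<open>opp e\<close>, here with \<open>e = Plus\<close>.\<close>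
      then show ?thesis using k pos_swap_node[of J Minus l] by (simp add: label_def)
    next
      case (LeafEnd i)
      then have "i < P.n" using k by (auto simp: junctions_def)
      then show ?thesis using k LeafEnd P.index_nth Q.index_nth same_n
        by (auto simp: label_def subint_def)
    next
      case (VertEnd i)
      then have "i < P.n" using k by (auto simp: junctions_def)
      then show ?thesis using k VertEnd P.index_nth Q.index_nth same_n P.pos_vert_end Q.pos_vert_end
        by (auto simp: label_def)
    qed
  next
    have to_leaf: "(x, Inl (Edge (subint I (label x)))) \<in> ?R" if x: "x \<in> link_arcs I J" for x
    proof -
      have R: "trans ?R" "refl ?R" by (simp_all add: trans_rtrancl refl_rtrancl)
      consider y where "x = Inl y" "y \<in> tree_arcs I" | y where "x = Inr y" "y \<in> tree_arcs J"
        using x by (auto simp: link_arcs_def)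
      then show ?thesis
      proof cases
        case 1
        obtain i where i: "i < P.n" "pos y = I ! i" using P.pos_nth[OF 1(2)] by metis
        have "(Inl y, Inl (Edge (subint I i))) \<in> ?R"
        proof (rule P.connected_to_leaf[OF R _ _ _ 1(2) i(2,1)])
          fix B assume B: "B \<in> tree_vertices I"
          show "(Inl (Edge B), Inl (Edge (left_half B))) \<in> ?R"
            using B flow_swapI[OF _ refl refl, of "TopNode (OverStrand B)"]
              flow_swapI[OF _ refl refl, of "TopNode (UnderStrand B)"]
            by (cases "edge_sign I B") (auto simp: junctions_def nodes_def)
          show "(Inl (Vert B), Inl (Edge (right_half B))) \<in> ?R"
            using B flow_swapI[OF _ refl refl, of "TopNode (OverStrand B)"]
              flow_swapI[OF _ refl refl, of "TopNode (UnderStrand B)"]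
            by (cases "edge_sign I B") (auto simp: junctions_def nodes_def)
        next
          show "(Inl FarLeft, Inl (Edge (0, 1))) \<in> ?R"
            using flow_swapI[OF _ refl refl, of "TopNode Cap"] by (auto simp: junctions_def nodes_def)
        qed
        then show ?thesis using 1 i P.index_nth by (simp add: label_def)
      next
        case 2
        obtain i where i: "i < Q.n" "pos y = J ! i" using Q.pos_nth[OF 2(2)] by metis
        have "(Inr y, Inr (Edge (subint J i))) \<in> ?R"
        proof (rule Q.connected_to_leaf[OF R _ _ _ 2(2) i(2,1)])
          fix B assume B: "B \<in> tree_vertices J"
          show "(Inr (Edge B), Inr (Edge (left_half B))) \<in> ?R"
            using B flow_swapI[OF _ refl refl, of "BottomNode (OverStrand B)"]
              flow_swapI[OF _ refl refl, of "BottomNode (UnderStrand B)"]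
            by (cases "edge_sign J B") (auto simp: junctions_def nodes_def)
          show "(Inr (Vert B), Inr (Edge (right_half B))) \<in> ?R"
            using B flow_swapI[OF _ refl refl, of "BottomNode (OverStrand B)"]
              flow_swapI[OF _ refl refl, of "BottomNode (UnderStrand B)"]
            by (cases "edge_sign J B") (auto simp: junctions_def nodes_def)
        next
          show "(Inr FarLeft, Inr (Edge (0, 1))) \<in> ?R"
            using flow_swapI[OF _ refl refl, of "BottomNode Cap"] by (auto simp: junctions_def nodes_def)
        qed
        \<comment> \<open>The join of the two leaves with index \<open>i\<close> leads from the
          lower tree to the upper one.\<close>
        moreover have "(Inr (Edge (subint J i)), Inl (Edge (subint I i))) \<in> ?R"
          using i same_n flow_swapI[OF _ refl refl, of "LeafEnd i"]
          by (cases "leaf_signs I ! i") (auto simp: junctions_def)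
        ultimately have "(Inr y, Inl (Edge (subint I i))) \<in> ?R" by (rule rtrancl_trans)
        then show ?thesis using 2 i Q.index_nth by (simp add: label_def)
      qed
    qed
    fix a b assume "a \<in> link_arcs I J" "b \<in> link_arcs I J" "label a = label b"
    then show "(a, b) \<in> ?R"
      using to_leaf[of a] to_leaf[of b] symclosure_rtrancl_sym rtrancl_trans by metis
  qed
  also have "label ` link_arcs I J = {..<P.n}"
  proof
    show "label ` link_arcs I J \<subseteq> {..<P.n}"
    proof
      fix m assume "m \<in> label ` link_arcs I J"
      then consider y where "m = P.index (pos y)" "y \<in> tree_arcs I"
        | y where "m = Q.index (pos y)" "y \<in> tree_arcs J"
        by (auto simp: label_def link_arcs_def)
      then show "m \<in> {..<P.n}"
      proof cases
        case 1
        then show ?thesis using P.pos_nth P.index_nth by (metis lessThan_iff)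
      next
        case 2
        then show ?thesis using Q.pos_nth Q.index_nth same_n by (metis lessThan_iff)
      qed
    qed
    show "{..<P.n} \<subseteq> label ` link_arcs I J"
    proof
      fix i assume "i \<in> {..<P.n}"
      then show "i \<in> label ` link_arcs I J"
        using P.subint_edge P.index_nth
        by (intro image_eqI[of _ _ "Inl (Edge (subint I i))"])
          (auto simp: label_def link_arcs_def tree_arcs_def subint_def)
    qed
  qed
  finally show ?thesis by simp
qed

lemma even_components: "even (card (link_components (pair_link I J)) + P.n)"
proof -
  \<comment> \<open>One element per crossing; \<open>?f\<close> and \<open>?g\<close> select its
    over- and its under-strand. The cap and the joins in the middle stay fixed.\<close>
  let ?C = "tree_vertices I <+> tree_vertices J"
  let ?f = "case_sum (TopNode \<circ> OverStrand) (BottomNode \<circ> OverStrand)"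
  let ?g = "case_sum (TopNode \<circ> UnderStrand) (BottomNode \<circ> UnderStrand)"
  have "even (component_count (link_arcs I J) (flow id) +
    component_count (link_arcs I J) (flow swap_junction) + card ?C)"
    unfolding flow_def id_apply
  proof (rule component_count_swap_parity[OF finite_link_arcs bij_incoming bij_incoming, of ?C ?f ?g])
    show "finite ?C" using P.finite_vertices Q.finite_vertices by simp
    show "inj_on ?f ?C" "inj_on ?g ?C" by (auto simp: inj_on_def)
    show "?f ` ?C \<inter> ?g ` ?C = {}" by auto
    show "?f ` ?C \<subseteq> junctions I J" "?g ` ?C \<subseteq> junctions I J"
      by (auto simp: junctions_def nodes_def)
    show "swap_junction (?f c) = ?g c" "swap_junction (?g c) = ?f c" for c by (cases c; simp)+
    show "swap_junction k = k" if k: "k \<in> junctions I J" "k \<notin> ?f ` ?C \<union> ?g ` ?C" for k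
    proof -
      have "?f (Inl B) \<noteq> k \<and> ?g (Inl B) \<noteq> k" if "B \<in> tree_vertices I" for B
        using that k(2) by (metis InlI UnCI imageI)
      moreover have "?f (Inr B) \<noteq> k \<and> ?g (Inr B) \<noteq> k" if "B \<in> tree_vertices J" for B
        using that k(2) by (metis InrI UnCI imageI)
      ultimately show ?thesis using k(1) by (auto simp: junctions_def nodes_def)
    qed
  qed
  moreover have "card ?C = 2 * (P.n - 1)"
    using P.card_vertices Q.card_vertices P.finite_vertices Q.finite_vertices same_n
    by (simp add: card_Plus)
  \<comment> \<open>\<open>component_count\<close> repeats the shape of
    \<open>link_components\<close>, so only the two symmetrized relations have to be
    exchanged.\<close>
  moreover have "card (link_components (pair_link I J)) = component_count (link_arcs I J) (flow id)"
    unfolding link_components_def same_component_def arcs_pair_link component_count_def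
      flow_id[symmetric] ..
  ultimately show ?thesis
    using component_count_smoothing by simp
qed

end

theorem theorem1p11:
  fixes g :: "real \<Rightarrow> real" and n :: nat
  assumes "g \<in> oriented_thompson_F"
    and "leaf_number g = n"
  shows "[card (link_components (thompson_link g)) = n] (mod 2)"
proof -
  obtain I J where IJ: "reduced_pair g = (I, J)" "represents I J g" "compatible I J"
    using assms(1) by (rule reduced_pair_oriented)
  interpret P: dyadic_partition I by (rule representsD(1)[OF IJ(2)])
  interpret Q: dyadic_partition J by (rule representsD(2)[OF IJ(2)])
  interpret compatible_pair I J
    using representsD(3)[OF IJ(2)] IJ(3) by unfold_locales (simp_all add: compatible_def)
  have "thompson_link g = pair_link I J" "n = num_subints I"
    using IJ(1) assms(2) by (simp_all add: thompson_link_def leaf_number_def)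
  then show ?thesis
    using even_components by (simp add: cong_def mod2_eq_if)
qed

end
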